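(* Let $\mathcal{C}$ be a congruence-modular and semi-degenerate variety such that, for each member $M$ of $\mathcal{C}$, $\mathcal{K}(M)$ is closed with respect to the commutator of $M$. Let $A,B$ be members of $\mathcal{C}$ and $f:A\to B$ a surjective morphism. Then the map $\mathcal{L}(f):\mathcal{L}(A)\to\mathcal{L}(B)$ given by $\mathcal{L}(f)(\widehat\alpha)=\widehat{f(\alpha\vee\mathrm{Ker}(f))}$ for all $\alpha\in\mathcal{K}(A)$ is well defined and it is a surjective lattice morphism.
   Context: $\mathcal{C}$ is a variety (equational class) of algebras of some signature; congruence-modular means every member has a modular congruence lattice; semi-degenerate means no non-trivial algebra in $\mathcal{C}$ has one-element subalgebras (equivalently, $\nabla_M$ is a compact congruence for all members $M$). For a member $M$, $\mathrm{Con}(M)$ is the complete lattice of congruences of $M$, with meet $\cap$, join $\vee$, least element $\Delta_M$ and greatest element $\nabla_M=M^2$; $\mathcal{K}(M)$ is the set of finitely generated (equivalently, compact) congruences of $M$. $\mathrm{Ker}(f)=\{(x,y)\in A^2\mid f(x)=f(y)\}$ and, for $X\subseteq A^2$, $f(X)=\{(f(a),f(b))\mid(a,b)\in X\}$; for $f$ surjective and $\alpha\in\mathrm{Con}(A)$, $f(\alpha\vee\mathrm{Ker}(f))\in\mathrm{Con}(B)$. Commutator: for $\alpha,\beta,\mu\in\mathrm{Con}(M)$, $C(\alpha,\beta;\mu)$ means: for all $n,k\in\mathbb{N}$ and every term $t$ of arity $n+k$, if $(a_i,b_i)\in\alpha$ for $1\le i\le n$ and $(c_j,d_j)\in\beta$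 for $1\le j\le k$, then $(t^M(\vec a,\vec c),t^M(\vec a,\vec d))\in\mu$ iff $(t^M(\vec b,\vec c),t^M(\vec b,\vec d))\in\mu$. Put $[\alpha,\beta]_M=\bigcap\{\mu\mid C(\alpha,\beta;\mu)\}$. In a congruence-modular variety it is commutative and distributive with respect to arbitrary joins in both arguments. A congruence $\phi\neq\nabla_M$ is prime iff $[\alpha,\beta]_M\subseteq\phi$ implies $\alpha\subseteq\phi$ or $\beta\subseteq\phi$; $\mathrm{Spec}(M)$ is the set of prime congruences; $\rho_M(\theta)=\bigcap\{\phi\in\mathrm{Spec}(M)\mid\theta\subseteq\phi\}$ (empty intersection $=\nabla_M$); $\alpha\equiv_M\beta$ iff $\rho_M(\alpha)=\rho_M(\beta)$; $\widehat\alpha$ is the $\equiv_M$-class of $\alpha$. $\mathcal{L}(M)=\{\widehat\alpha\mid\alpha\in\mathcal{K}(M)\}$ is a bounded distributive lattice with $\widehat\alpha\vee\widehat\beta=\widehat{\alpha\vee\beta}$, $\widehat\alpha\wedge\widehat\beta=\widehat{[\alpha,\beta]_M}$, $\mathbf 0=\widehat{\Delta_M}$, $\mathbf 1=\widehat{\nabla_M}$. *)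

theory Defs
  imports "HOL-Library.Equipollence"
begin

text \<open>
  A signature is a partial map from operation symbols to arities, so that the symbols in use need
  not exhaust the type \<open>'f\<close> (in particular the signature may be empty).
\<close>

record ('f, 'u) algebra =
  Sig :: "'f \<rightharpoonup> nat"
  Carr :: "'u set"
  Op :: "'f \<Rightarrow> 'u list \<Rightarrow> 'u"

definition is_algebra :: "('f, 'u) algebra \<Rightarrow> bool" where
  "is_algebra M \<longleftrightarrow> Carr M \<noteq> {} \<and>
     (\<forall>g n xs. Sig M g = Some n \<and> length xs = n \<and> set xs \<subseteq> Carr M \<longrightarrow> Op M g xs \<in> Carr M)"

definition subalgebra :: "('f, 'u) algebra \<Rightarrow> 'u set \<Rightarrow> bool" where
  "subalgebra M S \<longleftrightarrow> S \<noteq> {} \<and> S \<subseteq> Carr M \<and>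
     (\<forall>g n xs. Sig M g = Some n \<and> length xs = n \<and> set xs \<subseteq> S \<longrightarrow> Op M g xs \<in> S)"

definition alg_hom :: "('f, 'u) algebra \<Rightarrow> ('f, 'v) algebra \<Rightarrow> ('u \<Rightarrow> 'v) \<Rightarrow> bool" where
  "alg_hom A B f \<longleftrightarrow> Sig A = Sig B \<and> f ` Carr A \<subseteq> Carr B \<and>
     (\<forall>g n xs. Sig A g = Some n \<and> length xs = n \<and> set xs \<subseteq> Carr A \<longrightarrow>
        f (Op A g xs) = Op B g (map f xs))"

datatype 'f trm = Var nat | App 'f "'f trm list"

text \<open>\<open>is_trm \<Sigma> n t\<close>: \<open>t\<close> is a term of arity \<open>n\<close>, i.e. in the variables \<open>Var 0, \<dots>, Var (n - 1)\<close>.\<close>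

inductive is_trm :: "('f \<rightharpoonup> nat) \<Rightarrow> nat \<Rightarrow> 'f trm \<Rightarrow> bool" for \<Sigma> n where
  "i < n \<Longrightarrow> is_trm \<Sigma> n (Var i)"
| "\<Sigma> g = Some (length ts) \<Longrightarrow> (\<And>t. t \<in> set ts \<Longrightarrow> is_trm \<Sigma> n t) \<Longrightarrow> is_trm \<Sigma> n (App g ts)"

primrec trm_val :: "('f, 'u) algebra \<Rightarrow> (nat \<Rightarrow> 'u) \<Rightarrow> 'f trm \<Rightarrow> 'u" where
  "trm_val M e (Var i) = e i"
| "trm_val M e (App g ts) = Op M g (map (trm_val M e) ts)"

definition is_equations :: "('f \<rightharpoonup> nat) \<Rightarrow> ('f trm \<times> 'f trm) set \<Rightarrow> bool" where
  "is_equations \<Sigma> E \<longleftrightarrow> (\<forall>(s, t) \<in> E. \<exists>n. is_trm \<Sigma> n s \<and> is_trm \<Sigma> n t)"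

text \<open>
  The equational class defined by the equations \<open>E\<close>.  HOL cannot quantify over algebras of all
  types, so a class consists of algebras whose carrier is a subset of a type \<open>'u\<close>, which plays the
  role of a universe.  Nothing is lost if \<open>'u\<close> is assumed to be infinite and at least as large as the
  set of operation symbols: \<open>'u\<close> can always be chosen to satisfy this and to contain copies of any
  given algebras, and then it also contains copies of all countably generated free algebras.
\<close>

definition variety :: "('f \<rightharpoonup> nat) \<Rightarrow> ('f trm \<times> 'f trm) set \<Rightarrow> ('f, 'u) algebra set" where
  "variety \<Sigma> E = {M. is_algebra M \<and> Sig M = \<Sigma> \<and>
     (\<forall>(s, t) \<in> E. \<forall>e. range e \<subseteq> Carr M \<longrightarrow> trm_val M e s = trm_val M e t)}"


subsection \<open>Congruences\<close>

definition Con :: "('f, 'u) algebra \<Rightarrow> 'u rel set" where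
  "Con M = {\<theta>. equiv (Carr M) \<theta> \<and>
     (\<forall>g n xs ys. Sig M g = Some n \<and> length xs = n \<and> length ys = n \<and>
        (\<forall>i<n. (xs ! i, ys ! i) \<in> \<theta>) \<longrightarrow> (Op M g xs, Op M g ys) \<in> \<theta>)}"

definition nabla :: "('f, 'u) algebra \<Rightarrow> 'u rel" where
  "nabla M = Carr M \<times> Carr M"

definition Cg :: "('f, 'u) algebra \<Rightarrow> 'u rel \<Rightarrow> 'u rel" where
  "Cg M X = \<Inter>{\<theta> \<in> Con M. X \<subseteq> \<theta>}"

definition con_join :: "('f, 'u) algebra \<Rightarrow> 'u rel \<Rightarrow> 'u rel \<Rightarrow> 'u rel" where
  "con_join M \<alpha> \<beta> = Cg M (\<alpha> \<union> \<beta>)"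

definition fg_Con :: "('f, 'u) algebra \<Rightarrow> 'u rel set" where
  "fg_Con M = {Cg M X | X. finite X \<and> X \<subseteq> nabla M}"

definition Ker :: "('f, 'u) algebra \<Rightarrow> ('u \<Rightarrow> 'v) \<Rightarrow> 'u rel" where
  "Ker A f = {(x, y). x \<in> Carr A \<and> y \<in> Carr A \<and> f x = f y}"

definition rel_image :: "('u \<Rightarrow> 'v) \<Rightarrow> 'u rel \<Rightarrow> 'v rel" where
  "rel_image f X = {(f a, f b) | a b. (a, b) \<in> X}"

definition congruence_modular :: "('f, 'u) algebra set \<Rightarrow> bool" where
  "congruence_modular C \<longleftrightarrow> (\<forall>M \<in> C. \<forall>\<alpha> \<in> Con M. \<forall>\<beta> \<in> Con M. \<forall>\<gamma> \<in> Con M.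
     \<alpha> \<subseteq> \<gamma> \<longrightarrow> con_join M \<alpha> (\<beta> \<inter> \<gamma>) = con_join M \<alpha> \<beta> \<inter> \<gamma>)"

definition semi_degenerate :: "('f, 'u) algebra set \<Rightarrow> bool" where
  "semi_degenerate C \<longleftrightarrow> (\<forall>M \<in> C. (\<exists>x \<in> Carr M. \<exists>y \<in> Carr M. x \<noteq> y) \<longrightarrow>
     \<not> (\<exists>S. subalgebra M S \<and> card S = 1))"


subsection \<open>The commutator and prime congruences\<close>

text \<open>The assignment of the concatenated tuple \<open>(a 0, \<dots>, a (n - 1), c 0, c 1, \<dots>)\<close>.\<close>

definition tup_append :: "nat \<Rightarrow> (nat \<Rightarrow> 'u) \<Rightarrow> (nat \<Rightarrow> 'u) \<Rightarrow> nat \<Rightarrow> 'u" where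
  "tup_append n a c i = (if i < n then a i else c (i - n))"

definition centralizes :: "('f, 'u) algebra \<Rightarrow> 'u rel \<Rightarrow> 'u rel \<Rightarrow> 'u rel \<Rightarrow> bool" where
  "centralizes M \<alpha> \<beta> \<mu> \<longleftrightarrow> (\<forall>n k t a b c d.
     is_trm (Sig M) (n + k) t \<and> (\<forall>i<n. (a i, b i) \<in> \<alpha>) \<and> (\<forall>j<k. (c j, d j) \<in> \<beta>) \<longrightarrow>
       ((trm_val M (tup_append n a c) t, trm_val M (tup_append n a d) t) \<in> \<mu> \<longleftrightarrow>
        (trm_val M (tup_append n b c) t, trm_val M (tup_append n b d) t) \<in> \<mu>))"

definition commutator :: "('f, 'u) algebra \<Rightarrow> 'u rel \<Rightarrow> 'u rel \<Rightarrow> 'u rel" where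
  "commutator M \<alpha> \<beta> = \<Inter>{\<mu> \<in> Con M. centralizes M \<alpha> \<beta> \<mu>}"

definition Spec :: "('f, 'u) algebra \<Rightarrow> 'u rel set" where
  "Spec M = {\<phi> \<in> Con M. \<phi> \<noteq> nabla M \<and>
     (\<forall>\<alpha> \<in> Con M. \<forall>\<beta> \<in> Con M. commutator M \<alpha> \<beta> \<subseteq> \<phi> \<longrightarrow> \<alpha> \<subseteq> \<phi> \<or> \<beta> \<subseteq> \<phi>)}"

text \<open>Intersecting with \<open>nabla M\<close> makes the empty intersection equal to \<open>nabla M\<close>.\<close>

definition rad :: "('f, 'u) algebra \<Rightarrow> 'u rel \<Rightarrow> 'u rel" where
  "rad M \<theta> = nabla M \<inter> \<Inter>{\<phi> \<in> Spec M. \<theta> \<subseteq> \<phi>}"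

definition rad_eq :: "('f, 'u) algebra \<Rightarrow> 'u rel \<Rightarrow> 'u rel \<Rightarrow> bool" where
  "rad_eq M \<alpha> \<beta> \<longleftrightarrow> rad M \<alpha> = rad M \<beta>"

definition rad_class :: "('f, 'u) algebra \<Rightarrow> 'u rel \<Rightarrow> 'u rel set" where
  "rad_class M \<alpha> = {\<beta> \<in> Con M. rad_eq M \<alpha> \<beta>}"


subsection \<open>The lattice of classes of finitely generated congruences\<close>

definition L_carrier :: "('f, 'u) algebra \<Rightarrow> 'u rel set set" where
  "L_carrier M = rad_class M ` fg_Con M"

text \<open>
  Operations on classes are written as unions over all finitely generated representatives; such a
  union is the class of any one choice of representatives exactly when the operation is well defined.
\<close>

definition L_join :: "('f, 'u) algebra \<Rightarrow> 'u rel set \<Rightarrow> 'u rel set \<Rightarrow> 'u rel set" where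
  "L_join M X Y = (\<Union>\<alpha> \<in> X \<inter> fg_Con M. \<Union>\<beta> \<in> Y \<inter> fg_Con M. rad_class M (con_join M \<alpha> \<beta>))"

definition L_meet :: "('f, 'u) algebra \<Rightarrow> 'u rel set \<Rightarrow> 'u rel set \<Rightarrow> 'u rel set" where
  "L_meet M X Y = (\<Union>\<alpha> \<in> X \<inter> fg_Con M. \<Union>\<beta> \<in> Y \<inter> fg_Con M. rad_class M (commutator M \<alpha> \<beta>))"

definition L_map ::
    "('f, 'u) algebra \<Rightarrow> ('f, 'v) algebra \<Rightarrow> ('u \<Rightarrow> 'v) \<Rightarrow> 'u rel set \<Rightarrow> 'v rel set" where
  "L_map A B f X = (\<Union>\<alpha> \<in> X \<inter> fg_Con A. rad_class B (rel_image f (con_join A \<alpha> (Ker A f))))"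

definition lattice_on :: "'l set \<Rightarrow> ('l \<Rightarrow> 'l \<Rightarrow> 'l) \<Rightarrow> ('l \<Rightarrow> 'l \<Rightarrow> 'l) \<Rightarrow> bool" where
  "lattice_on L j m \<longleftrightarrow>
     (\<forall>x \<in> L. \<forall>y \<in> L. j x y \<in> L \<and> m x y \<in> L \<and> j x y = j y x \<and> m x y = m y x \<and>
        j x (m x y) = x \<and> m x (j x y) = x) \<and>
     (\<forall>x \<in> L. \<forall>y \<in> L. \<forall>z \<in> L. j (j x y) z = j x (j y z) \<and> m (m x y) z = m x (m y z))"

definition lattice_morphism_on ::
    "'l set \<Rightarrow> ('l \<Rightarrow> 'l \<Rightarrow> 'l) \<Rightarrow> ('l \<Rightarrow> 'l \<Rightarrow> 'l) \<Rightarrow>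
     'k set \<Rightarrow> ('k \<Rightarrow> 'k \<Rightarrow> 'k) \<Rightarrow> ('k \<Rightarrow> 'k \<Rightarrow> 'k) \<Rightarrow> ('l \<Rightarrow> 'k) \<Rightarrow> bool" where
  "lattice_morphism_on L j m L' j' m' h \<longleftrightarrow>
     lattice_on L j m \<and> lattice_on L' j' m' \<and> h ` L \<subseteq> L' \<and>
     (\<forall>x \<in> L. \<forall>y \<in> L. h (j x y) = j' (h x) (h y) \<and> h (m x y) = m' (h x) (h y))"

end

theory Submission
  imports Defs
begin

text \<open>
  Let \<open>V(\<alpha>)\<close> be the set of primes above \<open>\<alpha>\<close>.  Radical classes correspond to such sets, with
  \<open>V(\<alpha> \<or> \<beta>) = V(\<alpha>) \<inter> V(\<beta>)\<close> and \<open>V([\<alpha>, \<beta>]) = V(\<alpha>) \<union> V(\<beta>)\<close>.  A prime \<open>\<psi>\<close> of \<open>B\<close> lies above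
  \<open>f(\<alpha> \<or> Ker f)\<close> iff its inverse image lies above \<open>\<alpha>\<close>, so everything follows once inverse images
  of primes are known to be prime.  This is where modularity enters: \<open>C(\<alpha>, \<beta>; \<mu>)\<close> has to be
  equivalent to \<open>[\<alpha>, \<beta>] \<subseteq> \<mu>\<close> and symmetric in \<open>\<alpha>\<close> and \<open>\<beta>\<close>.  Instead of deriving Day terms from a
  free algebra, the modular law is applied directly to the subalgebra of \<open>A^4\<close> formed by the
  matrices that define the commutator.
\<close>

section \<open>Congruences\<close>

text \<open>Trading indices for \<open>list_all2\<close> absorbs the arity into the length of
  \<open>xs\<close> and opens the way to induction on lists.\<close>

lemma Con_iff:
  "\<theta> \<in> Con M \<longleftrightarrow> equiv (Carr M) \<theta> \<and>
     (\<forall>g xs ys. Sig M g = Some (length xs) \<and> list_all2 (\<lambda>x y. (x, y) \<in> \<theta>) xs ys \<longrightarrow>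
        (Op M g xs, Op M g ys) \<in> \<theta>)"
  unfolding Con_def list_all2_conv_all_nth by (auto; metis)

lemma Con_equiv: "\<theta> \<in> Con M \<Longrightarrow> equiv (Carr M) \<theta>"
  by (simp add: Con_iff)

lemma Con_sub: "\<theta> \<in> Con M \<Longrightarrow> \<theta> \<subseteq> nabla M"
  by (auto simp: nabla_def dest: Con_equiv equiv_type)

lemma Con_refl: "\<theta> \<in> Con M \<Longrightarrow> x \<in> Carr M \<Longrightarrow> (x, x) \<in> \<theta>"
  by (meson Con_equiv equivE refl_onD)

lemma Con_sym: "\<theta> \<in> Con M \<Longrightarrow> (x, y) \<in> \<theta> \<Longrightarrow> (y, x) \<in> \<theta>"
  by (meson Con_equiv equivE symD)

lemma Con_trans: "\<theta> \<in> Con M \<Longrightarrow> (x, y) \<in> \<theta> \<Longrightarrow> (y, z) \<in> \<theta> \<Longrightarrow> (x, z) \<in> \<theta>"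
  by (meson Con_equiv equivE transD)

lemma Con_op:
  "\<theta> \<in> Con M \<Longrightarrow> Sig M g = Some (length xs) \<Longrightarrow> list_all2 (\<lambda>x y. (x, y) \<in> \<theta>) xs ys \<Longrightarrow>
    (Op M g xs, Op M g ys) \<in> \<theta>"
  by (auto simp: Con_iff)

lemma ConI:
  assumes "\<theta> \<subseteq> nabla M"
    and "\<And>x. x \<in> Carr M \<Longrightarrow> (x, x) \<in> \<theta>"
    and "\<And>x y. (x, y) \<in> \<theta> \<Longrightarrow> (y, x) \<in> \<theta>"
    and "\<And>x y z. (x, y) \<in> \<theta> \<Longrightarrow> (y, z) \<in> \<theta> \<Longrightarrow> (x, z) \<in> \<theta>"
    and "\<And>g xs ys. Sig M g = Some (length xs) \<Longrightarrow> list_all2 (\<lambda>x y. (x, y) \<in> \<theta>) xs ys \<Longrightarrow>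
      (Op M g xs, Op M g ys) \<in> \<theta>"
  shows "\<theta> \<in> Con M"
  unfolding Con_iff
proof
  show "equiv (Carr M) \<theta>"
  proof (rule equivI)
    show "\<theta> \<subseteq> Carr M \<times> Carr M" using assms(1) by (simp add: nabla_def)
    show "refl_on (Carr M) \<theta>" using assms(2) by (rule refl_onI)
    show "sym \<theta>" using assms(3) by (rule symI)
    show "trans \<theta>" using assms(4) by (rule transI)
  qed
qed (simp add: assms(5))

lemma alg_op: "is_algebra M \<Longrightarrow> Sig M g = Some (length xs) \<Longrightarrow> set xs \<subseteq> Carr M \<Longrightarrow> Op M g xs \<in> Carr M"
  by (auto simp: is_algebra_def)

lemma nabla_Con: "is_algebra M \<Longrightarrow> nabla M \<in> Con M"
  by (rule ConI) (auto simp: nabla_def list_all2_conv_all_nth in_set_conv_nth subset_iff intro!: alg_op)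

lemma Id_on_Con: 
  assumes "is_algebra M" shows "Id_on (Carr M) \<in> Con M"
proof (rule ConI)
  fix g xs ys assume *: "Sig M g = Some (length xs)"
    and l: "list_all2 (\<lambda>x y. (x, y) \<in> Id_on (Carr M)) xs ys"
  from l have "xs = ys \<and> set xs \<subseteq> Carr M"
    by (induction rule: list_all2_induct) auto
  with * assms show "(Op M g xs, Op M g ys) \<in> Id_on (Carr M)" by (auto intro: alg_op)
qed (auto simp: nabla_def)

lemma Inter_Con: 
  assumes "S \<subseteq> Con M" "S \<noteq> {}" shows "\<Inter>S \<in> Con M"
proof (rule ConI)
  show "\<Inter>S \<subseteq> nabla M" using assms Con_sub by fastforce
next
  fix g xs ys assume *: "Sig M g = Some (length xs)" "list_all2 (\<lambda>x y. (x, y) \<in> \<Inter>S) xs ys"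
  show "(Op M g xs, Op M g ys) \<in> \<Inter>S"
  proof
    fix \<theta> assume "\<theta> \<in> S"
    moreover from this have "list_all2 (\<lambda>x y. (x, y) \<in> \<theta>) xs ys"
      using *(2) by (auto elim: list_all2_mono)
    ultimately show "(Op M g xs, Op M g ys) \<in> \<theta>" using assms * by (auto intro: Con_op)
  qed
next
  show "(x, x) \<in> \<Inter>S" if "x \<in> Carr M" for x
    using that assms(1) by (auto intro: Con_refl)
  show "(y, x) \<in> \<Inter>S" if "(x, y) \<in> \<Inter>S" for x y
  proof
    fix \<theta> assume "\<theta> \<in> S"
    then have "\<theta> \<in> Con M" "(x, y) \<in> \<theta>" using that assms(1) by auto
    then show "(y, x) \<in> \<theta>" by (rule Con_sym)
  qed
  show "(x, z) \<in> \<Inter>S" if "(x, y) \<in> \<Inter>S" "(y, z) \<in> \<Inter>S" for x y z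
  proof
    fix \<theta> assume "\<theta> \<in> S"
    then have "\<theta> \<in> Con M" "(x, y) \<in> \<theta>" "(y, z) \<in> \<theta>" using that assms(1) by auto
    then show "(x, z) \<in> \<theta>" by (rule Con_trans)
  qed
qed

lemma Int_Con: "\<alpha> \<in> Con M \<Longrightarrow> \<beta> \<in> Con M \<Longrightarrow> \<alpha> \<inter> \<beta> \<in> Con M"
  using Inter_Con[of "{\<alpha>, \<beta>}" M] by simp

section \<open>Generated congruences and joins\<close>

text \<open>The hypothesis on \<open>X\<close> puts \<open>nabla M\<close> into the family that is
  intersected. Over an empty family the intersection would be \<open>UNIV\<close>, which can exceed
  \<open>nabla M\<close>.\<close>

lemma Cg_Con: "is_algebra M \<Longrightarrow> X \<subseteq> nabla M \<Longrightarrow> Cg M X \<in> Con M"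
  unfolding Cg_def by (rule Inter_Con) (auto dest: nabla_Con)

lemma Cg_upper: "X \<subseteq> Cg M X"
  by (auto simp: Cg_def)

lemma Cg_least: "\<theta> \<in> Con M \<Longrightarrow> X \<subseteq> \<theta> \<Longrightarrow> Cg M X \<subseteq> \<theta>"
  by (auto simp: Cg_def)

lemma Cg_subset_iff: "\<theta> \<in> Con M \<Longrightarrow> Cg M X \<subseteq> \<theta> \<longleftrightarrow> X \<subseteq> \<theta>"
  using Cg_upper Cg_least by blast

lemma con_join_Con: "is_algebra M \<Longrightarrow> \<alpha> \<in> Con M \<Longrightarrow> \<beta> \<in> Con M \<Longrightarrow> con_join M \<alpha> \<beta> \<in> Con M"
  unfolding con_join_def by (rule Cg_Con) (auto dest: Con_sub)

lemma con_join_upper1: "\<alpha> \<subseteq> con_join M \<alpha> \<beta>" and con_join_upper2: "\<beta> \<subseteq> con_join M \<alpha> \<beta>"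
  using Cg_upper[of "\<alpha> \<union> \<beta>" M] by (simp_all add: con_join_def)

lemma con_join_subset_iff: "\<theta> \<in> Con M \<Longrightarrow> con_join M \<alpha> \<beta> \<subseteq> \<theta> \<longleftrightarrow> \<alpha> \<subseteq> \<theta> \<and> \<beta> \<subseteq> \<theta>"
  by (simp add: con_join_def Cg_subset_iff)

lemma fg_Con_Con: "is_algebra M \<Longrightarrow> \<alpha> \<in> fg_Con M \<Longrightarrow> \<alpha> \<in> Con M"
  by (auto simp: fg_Con_def intro: Cg_Con)

text \<open>A congruence contains \<open>Cg M X\<close> iff it contains \<open>X\<close>, so the
  union of two generating sets generates the join.\<close>

lemma con_join_fg:
  assumes "is_algebra M" "\<alpha> \<in> fg_Con M" "\<beta> \<in> fg_Con M"
  shows "con_join M \<alpha> \<beta> \<in> fg_Con M"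
proof -
  obtain X Y where X: "finite X" "X \<subseteq> nabla M" "\<alpha> = Cg M X"
    and Y: "finite Y" "Y \<subseteq> nabla M" "\<beta> = Cg M Y"
    using assms by (auto simp: fg_Con_def)
  have "con_join M \<alpha> \<beta> = Cg M (X \<union> Y)"
    unfolding con_join_def X Y Cg_def[of M "_ \<union> _"]
    by (intro arg_cong[where f = Inter] Collect_cong conj_cong) (simp_all add: Cg_subset_iff)
  then show ?thesis using X Y by (auto simp: fg_Con_def)
qed

section \<open>Joins as transitive closures\<close>

text \<open>Arguments are replaced one at a time and the resulting chains are concatenated; hence
  compatibility in a single argument is enough. It serves for unions of two compatible relations,
  which need not themselves be compatible with simultaneous changes.\<close>

lemma trancl_compatible:
  assumes sub: "R \<subseteq> D \<times> D"
    and refl: "\<And>x. x \<in> D \<Longrightarrow> (x, x) \<in> R"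
    and step: "\<And>us x y vs. set us \<subseteq> D \<Longrightarrow> set vs \<subseteq> D \<Longrightarrow> (x, y) \<in> R \<Longrightarrow>
      length us + length vs + 1 = n \<Longrightarrow> (F (us @ x # vs), F (us @ y # vs)) \<in> R"
    and nil: "n = 0 \<Longrightarrow> F [] \<in> D"
    and xs: "length xs = n" "list_all2 (\<lambda>x y. (x, y) \<in> R\<^sup>+) xs ys"
  shows "(F xs, F ys) \<in> R\<^sup>+"
proof -
  have D: "R\<^sup>+ \<subseteq> D \<times> D" using sub by (rule trancl_subset_Sigma)
  have one: "(F (us @ x # vs), F (us @ y # vs)) \<in> R\<^sup>+"
    if "(x, y) \<in> R\<^sup>+" "set us \<subseteq> D" "set vs \<subseteq> D" "length us + length vs + 1 = n" for us x y vs
    using that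
  proof (induction rule: trancl_induct)
    case (base y)
    then show ?case by (intro r_into_trancl step)
  next
    case (step y z)
    then have "(F (us @ y # vs), F (us @ z # vs)) \<in> R" by (intro assms(3))
    with step show ?case by (meson trancl.trancl_into_trancl)
  qed
  \<comment> \<open>\<open>us\<close> collects the entries already replaced, from left to right.
    Nonemptiness of \<open>xs\<close> ensures that at least one link exists; the nullary case is
    left to \<open>nil\<close>.\<close>
  have "(F (us @ xs), F (us @ ys)) \<in> R\<^sup>+"
    if "list_all2 (\<lambda>x y. (x, y) \<in> R\<^sup>+) xs ys" "set us \<subseteq> D" "length us + length xs = n"
      "xs \<noteq> []" for us xs ys
    using that
  proof (induction xs ys arbitrary: us rule: list_all2_induct)
    case (Cons x xs y ys)
    have s: "set xs \<subseteq> D" 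
      using Cons.hyps(2)
    proof (induction rule: list_all2_induct)
      case (Cons x xs y ys)
      then have "x \<in> D" using D by blast
      with Cons show ?case by simp
    qed simp
    have y: "y \<in> D" using Cons.hyps(1) D by blast
    have 1: "(F (us @ x # xs), F (us @ y # xs)) \<in> R\<^sup>+"
      using Cons.hyps(1) Cons.prems s by (intro one) simp_all
    show ?case
    proof (cases "xs = []")
      case True
      then show ?thesis using 1 Cons.hyps by simp
    next
      case False
      then have "(F ((us @ [y]) @ xs), F ((us @ [y]) @ ys)) \<in> R\<^sup>+"
        using Cons.prems y by (intro Cons.IH) simp_all
      then show ?thesis using 1 by (metis append.assoc append_Cons append_Nil trancl_trans)
    qed
  qed simp
  note * = this
  show ?thesis
  proof (cases "xs = []")
    case True
    then have "ys = []" "(F [], F []) \<in> R" using xs nil refl by simp_all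
    then show ?thesis using True by blast
  next
    case False
    then show ?thesis using *[of xs ys "[]"] xs by simp
  qed
qed

text \<open>The transitive closure is already a congruence above both. Membership in a join thereby
  becomes a finite chain on which induction is possible.\<close>

lemma con_join_subset_trancl:
  assumes M: "is_algebra M" and \<alpha>: "\<alpha> \<in> Con M" and \<beta>: "\<beta> \<in> Con M"
  shows "con_join M \<alpha> \<beta> \<subseteq> (\<alpha> \<union> \<beta>)\<^sup>+"
  unfolding con_join_def
proof (rule Cg_least)
  have sub: "\<alpha> \<union> \<beta> \<subseteq> Carr M \<times> Carr M" using \<alpha> \<beta> Con_sub unfolding nabla_def by blast
  show "(\<alpha> \<union> \<beta>)\<^sup>+ \<in> Con M"
  proof (rule ConI)
    show "(\<alpha> \<union> \<beta>)\<^sup>+ \<subseteq> nabla M" using sub unfolding nabla_def by (rule trancl_subset_Sigma)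
  next
    show "(y, x) \<in> (\<alpha> \<union> \<beta>)\<^sup>+" if "(x, y) \<in> (\<alpha> \<union> \<beta>)\<^sup>+" for x y
    proof -
      have "sym (\<alpha> \<union> \<beta>)" by (intro symI) (use Con_sym[OF \<alpha>] Con_sym[OF \<beta>] in blast)
      then show ?thesis using that by (meson sym_trancl symD)
    qed
  next
    fix g and xs ys :: "'b list"
    assume g: "Sig M g = Some (length xs)" and l: "list_all2 (\<lambda>x y. (x, y) \<in> (\<alpha> \<union> \<beta>)\<^sup>+) xs ys"
    show "(Op M g xs, Op M g ys) \<in> (\<alpha> \<union> \<beta>)\<^sup>+"
    proof (rule trancl_compatible[where F = "Op M g", OF sub _ _ _ refl l])
      fix us x y vs
      assume *: "set us \<subseteq> Carr M" "set vs \<subseteq> Carr M" "(x, y) \<in> \<alpha> \<union> \<beta>"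
        "length us + length vs + 1 = length xs"
      \<comment> \<open>All entries but one are unchanged and are related to themselves by
        reflexivity, so a link in \<alpha> stays in \<alpha> and a link in \<beta> stays in
        \<beta>.\<close>
      have "(Op M g (us @ x # vs), Op M g (us @ y # vs)) \<in> \<theta>"
        if "\<theta> \<in> Con M" "(x, y) \<in> \<theta>" for \<theta>
      proof (rule Con_op[OF that(1)])
        show "list_all2 (\<lambda>x y. (x, y) \<in> \<theta>) (us @ x # vs) (us @ y # vs)"
          using * that Con_refl[OF that(1)]
          by (simp add: list_all2_appendI list_all2_same subset_iff)
      qed (use g * in simp)
      then show "(Op M g (us @ x # vs), Op M g (us @ y # vs)) \<in> \<alpha> \<union> \<beta>"
        using *(3) \<alpha> \<beta> by (meson Un_iff)
    next
      show "(x, x) \<in> \<alpha> \<union> \<beta>" if "x \<in> Carr M" for x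
        using Con_refl[OF \<alpha> that] by simp
      show "Op M g [] \<in> Carr M" if "length xs = 0"
        using alg_op[OF M, of g "[]"] g that by simp
    qed
  next
    show "(x, x) \<in> (\<alpha> \<union> \<beta>)\<^sup>+" if "x \<in> Carr M" for x
      using Con_refl[OF \<alpha> that] by (simp add: r_into_trancl)
  next
    show "(x, z) \<in> (\<alpha> \<union> \<beta>)\<^sup>+" if "(x, y) \<in> (\<alpha> \<union> \<beta>)\<^sup>+" "(y, z) \<in> (\<alpha> \<union> \<beta>)\<^sup>+" for x y z
      using that by (rule trancl_trans)
  qed
next
  show "\<alpha> \<union> \<beta> \<subseteq> (\<alpha> \<union> \<beta>)\<^sup>+"
    by (simp add: subrelI r_into_trancl)
qed

section \<open>Homomorphisms\<close>

lemma alg_hom_op: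
  "alg_hom A B f \<Longrightarrow> Sig A g = Some (length xs) \<Longrightarrow> set xs \<subseteq> Carr A \<Longrightarrow>
    f (Op A g xs) = Op B g (map f xs)"
  unfolding alg_hom_def by blast

lemma alg_hom_Sig: "alg_hom A B f \<Longrightarrow> Sig A = Sig B"
  unfolding alg_hom_def by blast

lemma alg_hom_Carr: "alg_hom A B f \<Longrightarrow> x \<in> Carr A \<Longrightarrow> f x \<in> Carr B"
  unfolding alg_hom_def by blast

lemma alg_homI:
  assumes "Sig A = Sig B" "\<And>x. x \<in> Carr A \<Longrightarrow> f x \<in> Carr B"
    and "\<And>g xs. Sig A g = Some (length xs) \<Longrightarrow> set xs \<subseteq> Carr A \<Longrightarrow>
      f (Op A g xs) = Op B g (map f xs)"
  shows "alg_hom A B f"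
  using assms by (simp add: alg_hom_def image_subset_iff)

lemma alg_hom_comp:
  assumes f: "alg_hom A B f" and h: "alg_hom B D h"
  shows "alg_hom A D (h \<circ> f)"
proof (rule alg_homI)
  fix g xs assume *: "Sig A g = Some (length xs)" "set xs \<subseteq> Carr A"
  have "h (Op B g (map f xs)) = Op D g (map h (map f xs))"
  proof (rule alg_hom_op[OF h])
    show "Sig B g = Some (length (map f xs))" using * alg_hom_Sig[OF f] by simp
    show "set (map f xs) \<subseteq> Carr B" using *(2) alg_hom_Carr[OF f] by auto
  qed
  then show "(h \<circ> f) (Op A g xs) = Op D g (map (h \<circ> f) xs)"
    using alg_hom_op[OF f *] by simp
qed (simp_all add: alg_hom_Sig[OF f] alg_hom_Sig[OF h] alg_hom_Carr[OF f] alg_hom_Carr[OF h])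

lemma trm_val_Carr:
  assumes "is_algebra M" "is_trm (Sig M) n t" "\<And>i. i < n \<Longrightarrow> e i \<in> Carr M"
  shows "trm_val M e t \<in> Carr M"
  using assms(2)
proof (induction rule: is_trm.induct)
  case (2 g ts)
  then have "set (map (trm_val M e) ts) \<subseteq> Carr M" by auto
  then show ?case using 2(1) assms(1) by (simp del: set_map add: alg_op)
qed (simp add: assms(3))

lemma trm_val_hom:
  assumes "is_algebra A" "alg_hom A B f" "is_trm (Sig A) n t" "\<And>i. i < n \<Longrightarrow> e i \<in> Carr A"
  shows "f (trm_val A e t) = trm_val B (f \<circ> e) t"
  using assms(3)
proof (induction rule: is_trm.induct)
  case (2 g ts)
  have "trm_val A e t \<in> Carr A" if "t \<in> set ts" for t
    using assms(1) 2(2)[OF that] assms(4) by (rule trm_val_Carr)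
  then have "set (map (trm_val A e) ts) \<subseteq> Carr A" by auto
  then have "f (Op A g (map (trm_val A e) ts)) = Op B g (map f (map (trm_val A e) ts))"
    using 2(1) by (intro alg_hom_op[OF assms(2)]) simp_all
  also have "map f (map (trm_val A e) ts) = map (trm_val B (f \<circ> e)) ts" using 2(3) by (simp add: comp_def)
  finally show ?case by (simp only: trm_val.simps)
qed simp

text \<open>An equation can be tested after applying each \<open>h\<close>, because the family
  \<open>H\<close> separates points. This covers isomorphic copies of subalgebras of powers of
  \<open>A\<close> without constructing powers as members of the class.\<close>

lemma subdirect_in_variety:
  assumes M: "is_algebra M" "Sig M = \<Sigma>" and eqs: "is_equations \<Sigma> E"
    and H: "\<And>h. h \<in> H \<Longrightarrow> alg_hom M A h" and A: "A \<in> variety \<Sigma> E"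
    and inj: "\<And>x y. x \<in> Carr M \<Longrightarrow> y \<in> Carr M \<Longrightarrow> (\<And>h. h \<in> H \<Longrightarrow> h x = h y) \<Longrightarrow> x = y"
  shows "M \<in> variety \<Sigma> E"
  unfolding variety_def
proof (intro CollectI conjI M ballI, clarsimp)
  fix s t and e :: "nat \<Rightarrow> _" assume st: "(s, t) \<in> E" and e: "range e \<subseteq> Carr M"
  obtain n where n: "is_trm (Sig M) n s" "is_trm (Sig M) n t"
    using eqs st M by (auto simp: is_equations_def)
  show "trm_val M e s = trm_val M e t"
  proof (rule inj)
    fix h assume h: "h \<in> H"
    have "range (h \<circ> e) \<subseteq> Carr A" using alg_hom_Carr[OF H[OF h]] e by auto
    then have "trm_val A (h \<circ> e) s = trm_val A (h \<circ> e) t"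
      using A st by (auto simp: variety_def)
    then show "h (trm_val M e s) = h (trm_val M e t)"
      using trm_val_hom[OF M(1) H[OF h]] n e by (metis rangeI subsetD)
  qed (use M n e in \<open>auto intro!: trm_val_Carr\<close>)
qed

section \<open>Inverse and direct images of congruences\<close>

definition pull :: "('f, 'u) algebra \<Rightarrow> ('u \<Rightarrow> 'v) \<Rightarrow> 'v rel \<Rightarrow> 'u rel" where
  "pull A f \<theta> = {(x, y). x \<in> Carr A \<and> y \<in> Carr A \<and> (f x, f y) \<in> \<theta>}"

lemma pull_Con:
  assumes "is_algebra A" "alg_hom A B f" "\<theta> \<in> Con B"
  shows "pull A f \<theta> \<in> Con A"
proof (rule ConI)
  fix g xs ys assume g: "Sig A g = Some (length xs)"
    and l: "list_all2 (\<lambda>x y. (x, y) \<in> pull A f \<theta>) xs ys"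
  have s: "set xs \<subseteq> Carr A \<and> set ys \<subseteq> Carr A \<and> length xs = length ys
      \<and> list_all2 (\<lambda>x y. (x, y) \<in> \<theta>) (map f xs) (map f ys)"
    using l by (induction rule: list_all2_induct) (auto simp: pull_def)
  then have "(Op B g (map f xs), Op B g (map f ys)) \<in> \<theta>"
    using g assms(3) alg_hom_Sig[OF assms(2)] by (intro Con_op) simp_all
  then show "(Op A g xs, Op A g ys) \<in> pull A f \<theta>"
    using s g alg_op[OF assms(1)] alg_hom_op[OF assms(2)] by (simp add: pull_def)
next
  show "(x, x) \<in> pull A f \<theta>" if "x \<in> Carr A" for x
    using that Con_refl[OF assms(3)] alg_hom_Carr[OF assms(2)] by (simp add: pull_def)
next
  show "(y, x) \<in> pull A f \<theta>" if "(x, y) \<in> pull A f \<theta>" for x y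
    using that by (simp add: pull_def Con_sym[OF assms(3)])
  show "(x, z) \<in> pull A f \<theta>" if "(x, y) \<in> pull A f \<theta>" "(y, z) \<in> pull A f \<theta>" for x y z
    using that Con_trans[OF assms(3), of "f x" "f y" "f z"] by (simp add: pull_def)
qed (auto simp: pull_def nabla_def)

lemma Ker_Con: 
  assumes "is_algebra A" "is_algebra B" "alg_hom A B f" shows "Ker A f \<in> Con A"
proof -
  have "Ker A f = pull A f (Id_on (Carr B))"
    using alg_hom_Carr[OF assms(3)] by (auto simp: Ker_def pull_def)
  then show ?thesis using pull_Con assms Id_on_Con by metis
qed

lemma Ker_subset_pull:
  "alg_hom A B f \<Longrightarrow> \<theta> \<in> Con B \<Longrightarrow> Ker A f \<subseteq> pull A f \<theta>"
  by (simp add: Ker_def pull_def subset_iff Con_refl[OF _ alg_hom_Carr])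

text \<open>The adjunction between direct and inverse image, by which statements about
  \<open>rel_image\<close> are moved back to \<open>A\<close>.\<close>

lemma rel_image_subset_iff:
  "\<alpha> \<subseteq> nabla A \<Longrightarrow> rel_image f \<alpha> \<subseteq> \<theta> \<longleftrightarrow> \<alpha> \<subseteq> pull A f \<theta>"
  by (auto simp: rel_image_def pull_def nabla_def)

text \<open>A congruence above the kernel is saturated: \<open>x\<close> and \<open>y\<close> are
  joined by the chain \<open>x\<close>, \<open>a\<close>, \<open>b\<close>, \<open>y\<close>, whose
  outer links lie in the kernel.\<close>

lemma rel_imageD:
  assumes "\<theta> \<in> Con A" "Ker A f \<subseteq> \<theta>" "x \<in> Carr A" "y \<in> Carr A" "(f x, f y) \<in> rel_image f \<theta>"
  shows "(x, y) \<in> \<theta>"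
proof -
  obtain a b where ab: "(a, b) \<in> \<theta>" "f x = f a" "f y = f b"
    using assms(5) by (auto simp: rel_image_def)
  then have "a \<in> Carr A" "b \<in> Carr A" using Con_sub[OF assms(1)] by (auto simp: nabla_def)
  then have "(x, a) \<in> \<theta>" "(b, y) \<in> \<theta>" using ab assms by (auto simp: Ker_def)
  then show ?thesis using ab Con_trans[OF assms(1)] by blast
qed

text \<open>Surjectivity gives reflexivity. Transitivity needs the kernel below \<theta>, since two
  pairs with a common middle point may have been lifted with different middle points.\<close>

lemma rel_image_Con:
  assumes A: "is_algebra A" and f: "alg_hom A B f" "f ` Carr A = Carr B"
    and \<theta>: "\<theta> \<in> Con A" "Ker A f \<subseteq> \<theta>"
  shows "rel_image f \<theta> \<in> Con B"
proof (rule ConI)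
  show sub: "rel_image f \<theta> \<subseteq> nabla B"
    using alg_hom_Carr[OF f(1)] Con_sub[OF \<theta>(1)] unfolding rel_image_def nabla_def by blast
  show "(x, x) \<in> rel_image f \<theta>" if "x \<in> Carr B" for x
    using that Con_refl[OF \<theta>(1)] f(2) unfolding rel_image_def by blast
  show "(y, x) \<in> rel_image f \<theta>" if xy: "(x, y) \<in> rel_image f \<theta>" for x y
  proof -
    obtain a b where "(a, b) \<in> \<theta>" "x = f a" "y = f b"
      using xy by (auto simp: rel_image_def)
    with Con_sym[OF \<theta>(1), of a b] show ?thesis by (auto simp: rel_image_def)
  qed
  show "(x, z) \<in> rel_image f \<theta>" if xy: "(x, y) \<in> rel_image f \<theta>" "(y, z) \<in> rel_image f \<theta>" for x y z
  proof -
    obtain a b c where abc: "a \<in> Carr A" "b \<in> Carr A" "c \<in> Carr A" "x = f a" "y = f b" "z = f c"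
      using xy sub unfolding nabla_def f(2)[symmetric] by blast
    have "(a, b) \<in> \<theta>" "(b, c) \<in> \<theta>" using abc xy by (simp_all add: rel_imageD[OF \<theta>])
    then have "(a, c) \<in> \<theta>" by (rule Con_trans[OF \<theta>(1)])
    then show ?thesis using abc by (auto simp: rel_image_def)
  qed
  fix g xs ys assume g: "Sig B g = Some (length xs)"
    and l: "list_all2 (\<lambda>x y. (x, y) \<in> rel_image f \<theta>) xs ys"
  have "\<exists>us vs. xs = map f us \<and> ys = map f vs \<and> list_all2 (\<lambda>x y. (x, y) \<in> \<theta>) us vs"
    using l
  proof (induction rule: list_all2_induct)
    case (Cons x xs y ys)
    then obtain us vs a b where "xs = map f us" "ys = map f vs" "list_all2 (\<lambda>x y. (x, y) \<in> \<theta>) us vs"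
      "x = f a" "y = f b" "(a, b) \<in> \<theta>" by (auto simp: rel_image_def)
    then show ?case by (intro exI[of _ "a # us"] exI[of _ "b # vs"]) auto
  qed auto
  then obtain us vs where uv: "xs = map f us" "ys = map f vs" "list_all2 (\<lambda>x y. (x, y) \<in> \<theta>) us vs"
    by blast
  have s: "set us \<subseteq> Carr A \<and> set vs \<subseteq> Carr A \<and> length us = length vs"
    using uv(3) Con_sub[OF \<theta>(1)] by (induction rule: list_all2_induct) (auto simp: nabla_def)
  have "Sig A g = Some (length us)" using g uv alg_hom_Sig[OF f(1)] by simp
  then have "(Op A g us, Op A g vs) \<in> \<theta>" using uv(3) by (rule Con_op[OF \<theta>(1)])
  then have "(f (Op A g us), f (Op A g vs)) \<in> rel_image f \<theta>"
    unfolding rel_image_def by blast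
  then show "(Op B g xs, Op B g ys) \<in> rel_image f \<theta>"
    using s uv \<open>Sig A g = _\<close> by (simp add: alg_hom_op[OF f(1)])
qed

section \<open>Generated subalgebras and the matrices of the commutator\<close>

inductive_set Sg :: "('f, 'u) algebra \<Rightarrow> 'u set \<Rightarrow> 'u set" for M X where
  gen: "x \<in> X \<Longrightarrow> x \<in> Sg M X"
| op: "Sig M g = Some (length xs) \<Longrightarrow> (\<And>x. x \<in> set xs \<Longrightarrow> x \<in> Sg M X) \<Longrightarrow> Op M g xs \<in> Sg M X"

lemma Sg_mono: "X \<subseteq> Y \<Longrightarrow> Sg M X \<subseteq> Sg M Y"
proof
  fix x assume XY: "X \<subseteq> Y" and "x \<in> Sg M X"
  from this(2) show "x \<in> Sg M Y"
  proof induction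
    case (gen x)
    then show ?case using XY by (auto intro: Sg.gen)
  next
    case (op g xs)
    then show ?case by (intro Sg.op)
  qed
qed

lemma Sg_Carr:
  assumes "is_algebra M" "X \<subseteq> Carr M" shows "Sg M X \<subseteq> Carr M"
proof
  fix x assume "x \<in> Sg M X"
  then show "x \<in> Carr M" by induction (use assms in \<open>auto intro!: alg_op\<close>)
qed

text \<open>Operations are finitary, so finite supports of the arguments can be united. Terms have
  finitely many variables, and this makes them sufficient to describe generated elements.\<close>

lemma Sg_finite: "x \<in> Sg M X \<Longrightarrow> \<exists>F. finite F \<and> F \<subseteq> X \<and> x \<in> Sg M F"
proof (induction rule: Sg.induct)
  case (gen x)
  then show ?case by (intro exI[of _ "{x}"]) (auto intro: Sg.gen)
next
  case (op g xs)
  then obtain F where F: "\<And>x. x \<in> set xs \<Longrightarrow> finite (F x) \<and> F x \<subseteq> X \<and> x \<in> Sg M (F x)" by metis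
  then have "x \<in> Sg M (\<Union>(F ` set xs))" if "x \<in> set xs" for x
    using that Sg_mono[of "F x" "\<Union>(F ` set xs)" M] by blast
  then show ?case using F op by (intro exI[of _ "\<Union>(F ` set xs)"]) (auto intro: Sg.op)
qed

text \<open>Together with \<open>trm_val_Sg\<close> this translates between terms, in which the
  commutator is defined, and generated subalgebras, on which homomorphisms act.\<close>

lemma Sg_trm: "x \<in> Sg M (e ` {..<n}) \<Longrightarrow> \<exists>t. is_trm (Sig M) n t \<and> trm_val M e t = x"
proof (induction rule: Sg.induct)
  case (gen x)
  then obtain i where "i < n" "x = e i" by auto
  then show ?case by (intro exI[of _ "Var i"]) (auto intro: is_trm.intros)
next
  case (op g xs)
  then obtain t where t: "\<And>x. x \<in> set xs \<Longrightarrow> is_trm (Sig M) n (t x) \<and> trm_val M e (t x) = x" by metis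
  then have "map (trm_val M e) (map t xs) = xs" by (simp add: map_idI)
  then show ?case using t op
    by (intro exI[of _ "App g (map t xs)"]) (auto intro!: is_trm.intros)
qed

lemma trm_val_Sg:
  assumes "is_trm (Sig M) n t" "\<And>i. i < n \<Longrightarrow> e i \<in> X"
  shows "trm_val M e t \<in> Sg M X"
  using assms(1)
proof induction
  case (1 i)
  then show ?case by (simp add: assms(2) Sg.gen)
next
  case (2 g ts)
  have "Op M g (map (trm_val M e) ts) \<in> Sg M X"
    using 2 by (intro Sg.op) auto
  then show ?case by simp
qed

lemma Sg_image:
  assumes "is_algebra M" "alg_hom M N h" "X \<subseteq> Carr M"
  shows "h ` Sg M X = Sg N (h ` X)"
proof safe
  fix x assume "x \<in> Sg M X"
  then show "h x \<in> Sg N (h ` X)"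
  proof induction
    case (op g xs)
    then have "set xs \<subseteq> Carr M" using Sg_Carr[OF assms(1,3)] by blast
    then have "h (Op M g xs) = Op N g (map h xs)" by (rule alg_hom_op[OF assms(2) op(1)])
    moreover have "Op N g (map h xs) \<in> Sg N (h ` X)"
    proof (rule Sg.op)
      show "Sig N g = Some (length (map h xs))" using op(1) alg_hom_Sig[OF assms(2)] by simp
      show "y \<in> Sg N (h ` X)" if "y \<in> set (map h xs)" for y using that op(3) by auto
    qed
    ultimately show ?case by simp
  qed (auto intro: Sg.gen)
next
  fix y assume "y \<in> Sg N (h ` X)"
  then show "y \<in> h ` Sg M X"
  proof induction
    case (op g ys)
    then have "\<forall>y\<in>set ys. \<exists>x. x \<in> Sg M X \<and> h x = y" by blast
    then obtain k where k: "\<forall>y\<in>set ys. k y \<in> Sg M X \<and> h (k y) = y" by (rule bchoice[THEN exE])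
    then have 1: "map h (map k ys) = ys" by (simp add: map_idI)
    have 2: "set (map k ys) \<subseteq> Carr M" using k Sg_Carr[OF assms(1,3)] by auto
    have 3: "Sig M g = Some (length (map k ys))" using op(1) alg_hom_Sig[OF assms(2)] by simp
    have "h (Op M g (map k ys)) = Op N g ys" using alg_hom_op[OF assms(2) 3 2] 1 by simp
    moreover have "Op M g (map k ys) \<in> Sg M X"
      by (rule Sg.op[OF 3]) (use k in auto)
    ultimately show ?case by (metis imageI)
  next
    case (gen y)
    then show ?case using Sg.gen[of _ X M] by blast
  qed
qed

section \<open>Squares of algebras and matrices\<close>

text \<open>Taken twice, the direct square yields the fourth power as pairs of rows, so that a set
  of 2 by 2 matrices is a binary relation on rows.\<close>

definition sq :: "('f, 'u) algebra \<Rightarrow> ('f, 'u \<times> 'u) algebra" where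
  "sq M = \<lparr>Sig = Sig M, Carr = Carr M \<times> Carr M,
     Op = \<lambda>g zs. (Op M g (map fst zs), Op M g (map snd zs))\<rparr>"

lemma sq_simps [simp]:
  "Sig (sq M) = Sig M" "Carr (sq M) = Carr M \<times> Carr M"
  "Op (sq M) g zs = (Op M g (map fst zs), Op M g (map snd zs))"
  by (simp_all add: sq_def)

lemma is_algebra_sq:
  assumes "is_algebra M" shows "is_algebra (sq M)"
  unfolding is_algebra_def
proof (intro conjI allI impI)
  fix g n zs assume *: "Sig (sq M) g = Some n \<and> length zs = n \<and> set zs \<subseteq> Carr (sq M)"
  then have "set (map fst zs) \<subseteq> Carr M" "set (map snd zs) \<subseteq> Carr M" by auto
  then show "Op (sq M) g zs \<in> Carr (sq M)" using * alg_op[OF assms] by simp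
qed (use assms in \<open>simp add: is_algebra_def\<close>)

lemma trm_val_sq: "trm_val (sq M) e t = (trm_val M (fst \<circ> e) t, trm_val M (snd \<circ> e) t)"
  by (induction t) (auto cong: map_cong simp: comp_def)

lemma alg_hom_fst: "alg_hom (sq M) M fst" and alg_hom_snd: "alg_hom (sq M) M snd"
  by (auto intro!: alg_homI)

lemma alg_hom_sq:
  assumes h: "alg_hom M N h" shows "alg_hom (sq M) (sq N) (map_prod h h)"
proof (rule alg_homI)
  fix g xs assume *: "Sig (sq M) g = Some (length xs)" "set xs \<subseteq> Carr (sq M)"
  have "set (map fst xs) \<subseteq> Carr M" "set (map snd xs) \<subseteq> Carr M" using *(2) by auto
  then show "map_prod h h (Op (sq M) g xs) = Op (sq N) g (map (map_prod h h) xs)"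
    using *(1) by (simp add: alg_hom_op[OF h] comp_def)
qed (use alg_hom_Sig[OF h] alg_hom_Carr[OF h] in auto)

text \<open>
  A pair \<open>((a, b), (c, d))\<close> in \<open>mat M \<alpha> \<beta>\<close> is the matrix with rows \<open>(a, b)\<close>, \<open>(c, d)\<close>; rows are
  \<open>\<beta>\<close>-pairs and columns are \<open>\<alpha>\<close>-pairs.
\<close>

definition mat :: "('f, 'u) algebra \<Rightarrow> 'u rel \<Rightarrow> 'u rel \<Rightarrow> ('u \<times> 'u) rel" where
  "mat M \<alpha> \<beta> = Sg (sq (sq M))
     ((\<lambda>(x, y). ((x, x), (y, y))) ` \<alpha> \<union> (\<lambda>(x, y). ((x, y), (x, y))) ` \<beta>)"

lemma mat_left: "(x, y) \<in> \<alpha> \<Longrightarrow> ((x, x), (y, y)) \<in> mat M \<alpha> \<beta>"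
  unfolding mat_def by (rule Sg.gen) force

lemma mat_right: "(x, y) \<in> \<beta> \<Longrightarrow> ((x, y), (x, y)) \<in> mat M \<alpha> \<beta>"
  unfolding mat_def by (rule Sg.gen) force

lemma mat_op:
  assumes "Sig M g = Some (length xs)" "list_all2 (\<lambda>x y. (x, y) \<in> mat M \<alpha> \<beta>) xs ys"
  shows "(Op (sq M) g xs, Op (sq M) g ys) \<in> mat M \<alpha> \<beta>"
proof -
  have l: "length xs = length ys" using assms(2) by (rule list_all2_lengthD)
  have "Op (sq (sq M)) g (zip xs ys) \<in> mat M \<alpha> \<beta>"
    using assms l unfolding mat_def by (intro Sg.op) (auto simp: list_all2_iff)
  then show ?thesis using l by simp
qed

lemma mat_Carr:
  assumes "is_algebra M" "\<alpha> \<subseteq> nabla M" "\<beta> \<subseteq> nabla M"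
  shows "mat M \<alpha> \<beta> \<subseteq> Carr (sq (sq M))"
  unfolding mat_def using assms
  by (intro Sg_Carr is_algebra_sq) (auto simp: nabla_def)

text \<open>A term applied to columns from \<alpha> and rows from \<beta> gives a matrix with rows
  (t(a,c), t(a,d)) and (t(b,c), t(b,d)); the matrices in \<open>mat\<close> are exactly those
  obtained in this way.\<close>

lemma centralizes_iff:
  "centralizes M \<alpha> \<beta> \<mu> \<longleftrightarrow> (\<forall>(p, q) \<in> mat M \<alpha> \<beta>. p \<in> \<mu> \<longleftrightarrow> q \<in> \<mu>)"
proof
  assume c: "centralizes M \<alpha> \<beta> \<mu>"
  show "\<forall>(p, q) \<in> mat M \<alpha> \<beta>. p \<in> \<mu> \<longleftrightarrow> q \<in> \<mu>"
  proof safe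
    fix x y z w assume "((x, y), (z, w)) \<in> mat M \<alpha> \<beta>"
    from this[unfolded mat_def, THEN Sg_finite] obtain F where F: "finite F"
        "F \<subseteq> (\<lambda>(x, y). ((x, x), (y, y))) ` \<alpha> \<union> (\<lambda>(x, y). ((x, y), (x, y))) ` \<beta>"
        and m: "((x, y), (z, w)) \<in> Sg (sq (sq M)) F"
      by blast
    \<comment> \<open>The two kinds of generators are separated in order to number them as the first
      \<open>n\<close> and the last \<open>k\<close> variables; \<open>n = 0\<close> and
      \<open>k = 0\<close> cover the absence of a kind.\<close>
    obtain F1 F2 where F12: "F = F1 \<union> F2" "F1 \<subseteq> (\<lambda>(x, y). ((x, x), (y, y))) ` \<alpha>"
      "F2 \<subseteq> (\<lambda>(x, y). ((x, y), (x, y))) ` \<beta>" using F(2) by (rule subset_UnE)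
    obtain P where P: "P \<subseteq> \<alpha>" "finite P" "F1 = (\<lambda>(x, y). ((x, x), (y, y))) ` P"
      using finite_subset_image[OF _ F12(2)] F(1) F12(1) by auto
    obtain Q where Q: "Q \<subseteq> \<beta>" "finite Q" "F2 = (\<lambda>(x, y). ((x, y), (x, y))) ` Q"
      using finite_subset_image[OF _ F12(3)] F(1) F12(1) by auto
    obtain n p where p: "P = p ` {i::nat. i < n}"
      using P(2) by (metis finite_imp_nat_seg_image_inj_on)
    obtain k q where q: "Q = q ` {i::nat. i < k}"
      using Q(2) by (metis finite_imp_nat_seg_image_inj_on)
    define a b c d where "a = fst \<circ> p" "b = snd \<circ> p" "c = fst \<circ> q" "d = snd \<circ> q"
    note abcd = this
    \<comment> \<open>The four assignments of \<open>centralizes\<close> bundled into one assignment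
      in the fourth power; its values at the variables are the chosen generators.\<close>
    define e where "e i = ((tup_append n a c i, tup_append n a d i),
      (tup_append n b c i, tup_append n b d i))" for i
    have "F \<subseteq> e ` {..<n + k}"
    proof
      fix v assume "v \<in> F"
      then consider i where "i < n" "v = (\<lambda>(x, y). ((x, x), (y, y))) (p i)"
        | j where "j < k" "v = (\<lambda>(x, y). ((x, y), (x, y))) (q j)"
        unfolding F12(1) P(3) Q(3) p q by blast
      then show "v \<in> e ` {..<n + k}"
      proof cases
        case 1
        then have "v = e i" by (auto simp: e_def tup_append_def abcd split: prod.split)
        then show ?thesis using 1 by auto
      next
        case 2
        then have "v = e (n + j)" by (auto simp: e_def tup_append_def abcd split: prod.split)
        then show ?thesis using 2 by auto
      qed
    qed
    then have "((x, y), (z, w)) \<in> Sg (sq (sq M)) (e ` {..<n + k})" using m by (rule Sg_mono[THEN subsetD])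
    from Sg_trm[OF this] obtain t where t: "is_trm (Sig M) (n + k) t"
      "trm_val (sq (sq M)) e t = ((x, y), (z, w))" by auto
    have "x = trm_val M (tup_append n a c) t" "y = trm_val M (tup_append n a d) t"
       "z = trm_val M (tup_append n b c) t" "w = trm_val M (tup_append n b d) t"
      using t(2) by (simp_all add: trm_val_sq comp_def e_def)
    moreover have "is_trm (Sig M) (n + k) t \<and> (\<forall>i<n. (a i, b i) \<in> \<alpha>) \<and> (\<forall>j<k. (c j, d j) \<in> \<beta>)"
      using P(1) Q(1) p q t(1) by (auto simp: abcd)
    note c[unfolded centralizes_def, rule_format, OF this]
    ultimately have "(x, y) \<in> \<mu> \<longleftrightarrow> (z, w) \<in> \<mu>" by simp
    then show "(x, y) \<in> \<mu> \<Longrightarrow> (z, w) \<in> \<mu>" "(z, w) \<in> \<mu> \<Longrightarrow> (x, y) \<in> \<mu>" by auto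
  qed
next
  assume m: "\<forall>(p, q) \<in> mat M \<alpha> \<beta>. p \<in> \<mu> \<longleftrightarrow> q \<in> \<mu>"
  show "centralizes M \<alpha> \<beta> \<mu>"
    unfolding centralizes_def
  proof (intro allI impI, elim conjE)
    fix n k t a b c d
    assume t: "is_trm (Sig M) (n + k) t" and ab: "\<forall>i<n. (a i, b i) \<in> \<alpha>"
      and cd: "\<forall>j<k. (c j, d j) \<in> \<beta>"
    define e where "e i = ((tup_append n a c i, tup_append n a d i),
      (tup_append n b c i, tup_append n b d i))" for i
    have "trm_val (sq (sq M)) e t \<in> mat M \<alpha> \<beta>"
      unfolding mat_def
    proof (rule trm_val_Sg)
      fix i assume i: "i < n + k"
      show "e i \<in> (\<lambda>(x, y). ((x, x), (y, y))) ` \<alpha> \<union> (\<lambda>(x, y). ((x, y), (x, y))) ` \<beta>"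
      proof (cases "i < n")
        case True
        then have "e i = (\<lambda>(x, y). ((x, x), (y, y))) (a i, b i)" by (simp add: e_def tup_append_def)
        then show ?thesis using ab True by blast
      next
        case False
        then have "e i = (\<lambda>(x, y). ((x, y), (x, y))) (c (i - n), d (i - n))"
          by (simp add: e_def tup_append_def)
        moreover have "i - n < k" using i False by simp
        ultimately show ?thesis using cd by blast
      qed
    qed (use t in simp)
    then show "(trm_val M (tup_append n a c) t, trm_val M (tup_append n a d) t) \<in> \<mu> \<longleftrightarrow>
        (trm_val M (tup_append n b c) t, trm_val M (tup_append n b d) t) \<in> \<mu>"
      using m by (auto simp: trm_val_sq comp_def e_def)
  qed
qed


lemma mat_cols:
  assumes "is_algebra M" "\<alpha> \<in> Con M" "\<beta> \<in> Con M" "((a, b), (c, d)) \<in> mat M \<alpha> \<beta>"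
  shows "(a, b) \<in> \<beta>" "(c, d) \<in> \<beta>" "(a, c) \<in> \<alpha>" "(b, d) \<in> \<alpha>"
proof -
  note sub = Con_sub[OF assms(2)] Con_sub[OF assms(3)]
  define T where "T = {((a, b), (c, d)). (a, b) \<in> \<beta> \<and> (c, d) \<in> \<beta> \<and> (a, c) \<in> \<alpha> \<and> (b, d) \<in> \<alpha>}"
  have "x \<in> T" if "x \<in> mat M \<alpha> \<beta>" for x
    using that unfolding mat_def
  proof induction
    case (gen x)
    then show ?case using sub Con_refl[OF assms(2)] Con_refl[OF assms(3)]
      by (auto simp: T_def nabla_def)
  next
    case (op g xs)
    \<comment> \<open>Each of the four conditions in \<open>T\<close> relates two entries
      \<open>h x\<close> and \<open>k x\<close> by a congruence, so one argument serves for
      all.\<close>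
    have *: "(Op M g (map h xs), Op M g (map k xs)) \<in> \<theta>"
      if "\<theta> \<in> Con M" "\<And>x. x \<in> T \<Longrightarrow> (h x, k x) \<in> \<theta>" for \<theta> h k
    proof (rule Con_op[OF that(1)])
      show "list_all2 (\<lambda>x y. (x, y) \<in> \<theta>) (map h xs) (map k xs)"
        using op that(2) by (auto simp: list_all2_map1 list_all2_map2 list_all2_same)
    qed (use op in simp)
    have "(fst (fst x), snd (fst x)) \<in> \<beta>" "(fst (snd x), snd (snd x)) \<in> \<beta>"
      "(fst (fst x), fst (snd x)) \<in> \<alpha>" "(snd (fst x), snd (snd x)) \<in> \<alpha>" if "x \<in> T" for x
      using that by (auto simp: T_def)
    then show ?case using *[OF assms(2)] *[OF assms(3)] by (simp add: T_def comp_def)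
  qed
  then show "(a, b) \<in> \<beta>" "(c, d) \<in> \<beta>" "(a, c) \<in> \<alpha>" "(b, d) \<in> \<alpha>"
    using assms(4) by (auto simp: T_def)
qed

text \<open>Permuting entries is an endomorphism of the fourth power, so only generators matter:
  those from \<alpha> are fixed, those from \<beta> are reversed, and \<beta> is symmetric.\<close>

lemma mat_swap_cols:
  assumes M: "is_algebra M" and \<alpha>: "\<alpha> \<subseteq> nabla M" and \<beta>: "\<beta> \<in> Con M"
    and m: "((a, b), (c, d)) \<in> mat M \<alpha> \<beta>"
  shows "((b, a), (d, c)) \<in> mat M \<alpha> \<beta>"
proof -
  let ?G = "(\<lambda>(x, y). ((x, x), (y, y))) ` \<alpha> \<union> (\<lambda>(x, y). ((x, y), (x, y))) ` \<beta>"
  let ?h = "\<lambda>((a, b), (c, d)). ((b, a), (d, c))"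
  have "alg_hom (sq (sq M)) (sq (sq M)) ?h"
    by (rule alg_homI) (auto simp: comp_def split_beta)
  moreover have "?G \<subseteq> Carr (sq (sq M))" using \<alpha> Con_sub[OF \<beta>] by (auto simp: nabla_def)
  ultimately have "?h ` mat M \<alpha> \<beta> = Sg (sq (sq M)) (?h ` ?G)"
    unfolding mat_def by (intro Sg_image is_algebra_sq M)
  moreover have "?h ` ?G \<subseteq> ?G"
    using Con_sym[OF \<beta>] by force
  ultimately have "?h ` mat M \<alpha> \<beta> \<subseteq> mat M \<alpha> \<beta>"
    by (simp only: mat_def[of M \<alpha> \<beta>] Sg_mono)
  then have "?h ((a, b), (c, d)) \<in> mat M \<alpha> \<beta>" using m by (blast intro: imageI)
  then show ?thesis by simp
qed

text \<open>Transposition is likewise an endomorphism, and it exchanges the two kinds of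
  generators.\<close>

lemma mat_transpose:
  assumes M: "is_algebra M" and sub: "\<alpha> \<subseteq> nabla M" "\<beta> \<subseteq> nabla M"
    and m: "((a, b), (c, d)) \<in> mat M \<alpha> \<beta>"
  shows "((a, c), (b, d)) \<in> mat M \<beta> \<alpha>"
proof -
  let ?G = "\<lambda>\<alpha> \<beta>. (\<lambda>(x, y). ((x, x), (y, y))) ` \<alpha> \<union> (\<lambda>(x, y). ((x, y), (x, y))) ` \<beta>"
  let ?h = "\<lambda>((a, b), (c, d)). ((a, c), (b, d))"
  have "alg_hom (sq (sq M)) (sq (sq M)) ?h"
    by (rule alg_homI) (auto simp: comp_def split_beta)
  moreover have "?G \<alpha> \<beta> \<subseteq> Carr (sq (sq M))" using sub by (auto simp: nabla_def)
  ultimately have "?h ` mat M \<alpha> \<beta> = Sg (sq (sq M)) (?h ` ?G \<alpha> \<beta>)"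
    unfolding mat_def by (intro Sg_image is_algebra_sq M)
  moreover have "?h ` ?G \<alpha> \<beta> \<subseteq> ?G \<beta> \<alpha>" by force
  ultimately have "?h ` mat M \<alpha> \<beta> \<subseteq> mat M \<beta> \<alpha>"
    by (simp only: mat_def[of M \<beta> \<alpha>] Sg_mono)
  then have "?h ((a, b), (c, d)) \<in> mat M \<beta> \<alpha>" using m by (blast intro: imageI)
  then show ?thesis by simp
qed

section \<open>Basic properties of the commutator\<close>

text \<open>In matrix form the condition says that \<mu> does not separate the two rows of a matrix,
  and this passes to intersections.\<close>

lemma centralizes_commutator: "centralizes M \<alpha> \<beta> (commutator M \<alpha> \<beta>)"
  unfolding centralizes_iff commutator_def by fast

lemma commutator_least: "\<mu> \<in> Con M \<Longrightarrow> centralizes M \<alpha> \<beta> \<mu> \<Longrightarrow> commutator M \<alpha> \<beta> \<subseteq> \<mu>"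
  by (auto simp: commutator_def)

text \<open>Both congruences are admissible values of \<mu>: for \<beta> every row is a
  \<beta>-pair, for \<alpha> one row is carried to the other along the columns.\<close>

lemma commutator_le:
  assumes M: "is_algebra M" and con: "\<alpha> \<in> Con M" "\<beta> \<in> Con M"
  shows "commutator M \<alpha> \<beta> \<subseteq> \<alpha>" "commutator M \<alpha> \<beta> \<subseteq> \<beta>"
proof -
  have "(a, b) \<in> \<alpha> \<longleftrightarrow> (c, d) \<in> \<alpha>" if "((a, b), (c, d)) \<in> mat M \<alpha> \<beta>" for a b c d
    using mat_cols(3,4)[OF M con that] Con_sym[OF con(1)] Con_trans[OF con(1)] by meson
  then show "commutator M \<alpha> \<beta> \<subseteq> \<alpha>"
    by (intro commutator_least con) (auto simp: centralizes_iff)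
  have "(a, b) \<in> \<beta> \<longleftrightarrow> (c, d) \<in> \<beta>" if "((a, b), (c, d)) \<in> mat M \<alpha> \<beta>" for a b c d
    using mat_cols(1,2)[OF M con that] by simp
  then show "commutator M \<alpha> \<beta> \<subseteq> \<beta>"
    by (intro commutator_least con) (auto simp: centralizes_iff)
qed

lemma commutator_Con:
  assumes M: "is_algebra M" and con: "\<alpha> \<in> Con M" "\<beta> \<in> Con M"
  shows "commutator M \<alpha> \<beta> \<in> Con M"
  unfolding commutator_def
proof (rule Inter_Con)
  \<comment> \<open>The congruence \<beta> witnesses that the family is nonempty.\<close>
  have "(a, b) \<in> \<beta> \<longleftrightarrow> (c, d) \<in> \<beta>" if "((a, b), (c, d)) \<in> mat M \<alpha> \<beta>" for a b c d
    using mat_cols(1,2)[OF M con that] by simp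
  then have "centralizes M \<alpha> \<beta> \<beta>" by (auto simp: centralizes_iff)
  then show "{\<mu> \<in> Con M. centralizes M \<alpha> \<beta> \<mu>} \<noteq> {}" using con(2) by blast
qed simp

text \<open>A matrix for the join is cut into a chain of rows in which any two neighbours form a
  matrix for \<alpha> or for \<gamma>. The chain relation contains the generators and is compatible
  by \<open>trancl_compatible\<close>, now on the rows, which lie in \<beta>.\<close>

lemma mat_con_join:
  assumes M: "is_algebra M" and con: "\<alpha> \<in> Con M" "\<gamma> \<in> Con M" "\<beta> \<in> Con M"
  shows "mat M (con_join M \<alpha> \<gamma>) \<beta> \<subseteq> (mat M \<alpha> \<beta> \<union> mat M \<gamma> \<beta>)\<^sup>+"
proof -
  define T where "T = mat M \<alpha> \<beta> \<union> mat M \<gamma> \<beta>"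
  have sub: "T \<subseteq> \<beta> \<times> \<beta>"
  proof -
    have "p \<in> \<beta> \<and> q \<in> \<beta>" if "(p, q) \<in> mat M \<theta> \<beta>" "\<theta> \<in> Con M" for p q \<theta>
      using mat_cols(1,2)[OF M that(2) con(3), of "fst p" "snd p" "fst q" "snd q"] that(1) by simp
    then have "mat M \<theta> \<beta> \<subseteq> \<beta> \<times> \<beta>" if "\<theta> \<in> Con M" for \<theta> using that by auto
    then show ?thesis using con(1,2) unfolding T_def by simp
  qed
  have diag: "((x, x), (y, y)) \<in> T\<^sup>+" if "(x, y) \<in> (\<alpha> \<union> \<gamma>)\<^sup>+" for x y
    using that
  proof induction
    case (base y)
    then have "((x, x), (y, y)) \<in> T" unfolding T_def using mat_left by (metis UnE UnI1 UnI2)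
    then show ?case by (rule r_into_trancl)
  next
    case (step y z)
    then have "((y, y), (z, z)) \<in> T" unfolding T_def using mat_left by (metis UnE UnI1 UnI2)
    with step.IH show ?case by (rule trancl_into_trancl)
  qed
  have "x \<in> T\<^sup>+" if "x \<in> mat M (con_join M \<alpha> \<gamma>) \<beta>" for x
    using that unfolding mat_def[of M "con_join M \<alpha> \<gamma>"]
  proof induction
    case (gen x)
    then consider a b where "(a, b) \<in> con_join M \<alpha> \<gamma>" "x = ((a, a), (b, b))"
      | a b where "(a, b) \<in> \<beta>" "x = ((a, b), (a, b))" by force
    then show ?case
    proof cases
      case 1
      then show ?thesis using con_join_subset_trancl[OF M con(1,2)] diag by blast
    next
      case 2
      then have "x \<in> T" by (simp add: T_def mat_right)
      then show ?thesis by (cases x) (simp add: r_into_trancl)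
    qed
  next
    case (op g xs)
    have g: "Sig M g = Some (length xs)" using op(1) by simp
    have "(Op (sq M) g (map fst xs), Op (sq M) g (map snd xs)) \<in> T\<^sup>+"
    proof (rule trancl_compatible[where F = "Op (sq M) g" and n = "length xs", OF sub])
      show "(x, x) \<in> T" if "x \<in> \<beta>" for x
        using that mat_right[of "fst x" "snd x" \<beta> M \<alpha>] by (simp add: T_def)
      show "Op (sq M) g [] \<in> \<beta>" if "length xs = 0"
        using Con_op[OF con(3), of g "[]" "[]"] g that by simp
      show "list_all2 (\<lambda>x y. (x, y) \<in> T\<^sup>+) (map fst xs) (map snd xs)"
        using op(3) by (simp add: list_all2_map1 list_all2_map2 list_all2_same)
      fix us x y vs
      assume *: "set us \<subseteq> \<beta>" "set vs \<subseteq> \<beta>" "(x, y) \<in> T" "length us + length vs + 1 = length xs"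
      have "(Op (sq M) g (us @ x # vs), Op (sq M) g (us @ y # vs)) \<in> mat M \<theta> \<beta>"
        if "(x, y) \<in> mat M \<theta> \<beta>" for \<theta>
      proof (rule mat_op)
        have "(z, z) \<in> mat M \<theta> \<beta>" if "z \<in> \<beta>" for z
          using that mat_right[of "fst z" "snd z" \<beta> M \<theta>] by simp
        then show "list_all2 (\<lambda>x y. (x, y) \<in> mat M \<theta> \<beta>) (us @ x # vs) (us @ y # vs)"
          using * that by (intro list_all2_appendI) (auto simp: list_all2_same)
      qed (use g * in simp)
      then show "(Op (sq M) g (us @ x # vs), Op (sq M) g (us @ y # vs)) \<in> T"
        using *(3) unfolding T_def by blast
    qed simp
    then show ?case by (simp only: sq_simps(3)[of "sq M"])
  qed
  then show ?thesis unfolding T_def by blast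
qed

text \<open>Membership of a row in \<mu> propagates along the chain from
  \<open>mat_con_join\<close>. This supplies the additivity of the commutator in its first
  argument.\<close>

lemma centralizes_con_join:
  assumes "is_algebra M" "\<alpha> \<in> Con M" "\<gamma> \<in> Con M" "\<beta> \<in> Con M"
    and c: "centralizes M \<alpha> \<beta> \<mu>" "centralizes M \<gamma> \<beta> \<mu>"
  shows "centralizes M (con_join M \<alpha> \<gamma>) \<beta> \<mu>"
proof -
  have "p \<in> \<mu> \<longleftrightarrow> q \<in> \<mu>" if "(p, q) \<in> (mat M \<alpha> \<beta> \<union> mat M \<gamma> \<beta>)\<^sup>+" for p q
    using that by induction (use c in \<open>auto simp: centralizes_iff\<close>)
  then show ?thesis
    unfolding centralizes_iff using mat_con_join[OF assms(1-4)] by blast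
qed

text \<open>The map carries generating matrices onto generating matrices, hence the matrices over
  \<open>B\<close> are exactly the images of those over \<open>A\<close>.\<close>

lemma centralizes_rel_image:
  assumes A: "is_algebra A" and f: "alg_hom A B f" and sub: "\<alpha> \<subseteq> nabla A" "\<beta> \<subseteq> nabla A"
    and c: "centralizes A \<alpha> \<beta> (pull A f \<psi>)"
  shows "centralizes B (rel_image f \<alpha>) (rel_image f \<beta>) \<psi>"
proof -
  let ?G = "\<lambda>\<alpha> \<beta>. (\<lambda>(x, y). ((x, x), (y, y))) ` \<alpha> \<union> (\<lambda>(x, y). ((x, y), (x, y))) ` \<beta>"
  let ?h = "map_prod (map_prod f f) (map_prod f f)"
  have G: "?h ` ?G \<alpha> \<beta> = ?G (rel_image f \<alpha>) (rel_image f \<beta>)"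
    unfolding rel_image_def by (auto simp: image_iff) force+
  have "mat B (rel_image f \<alpha>) (rel_image f \<beta>) = ?h ` mat A \<alpha> \<beta>"
    unfolding mat_def G[symmetric]
    by (rule Sg_image[OF is_algebra_sq[OF is_algebra_sq[OF A]] alg_hom_sq[OF alg_hom_sq[OF f]], symmetric])
      (use sub in \<open>auto simp: nabla_def\<close>)
  moreover have "map_prod f f p \<in> \<psi> \<longleftrightarrow> map_prod f f q \<in> \<psi>" if "(p, q) \<in> mat A \<alpha> \<beta>" for p q
  proof -
    have "p \<in> nabla A" "q \<in> nabla A"
      using mat_Carr[OF A sub] that by (auto simp: nabla_def)
    moreover have "p \<in> pull A f \<psi> \<longleftrightarrow> q \<in> pull A f \<psi>"
      using c that by (auto simp: centralizes_iff)
    ultimately show ?thesis by (cases p, cases q) (simp add: pull_def nabla_def)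
  qed
  ultimately show ?thesis by (auto simp: centralizes_iff)
qed

section \<open>The commutator in congruence-modular varieties\<close>

text \<open>An infinite type is equipotent to its fourth power. Matrix algebras can therefore be
  copied into the universe type and become candidates for membership in the variety.\<close>

lemma copy_into_infinite:
  assumes "infinite (UNIV :: 'u set)"
  obtains q :: "'u \<Rightarrow> ('u \<times> 'u) \<times> ('u \<times> 'u)" where "bij q"
proof -
  have "(UNIV :: 'u set) \<times> (UNIV :: 'u set) \<approx> (UNIV :: 'u set)"
    unfolding eqpoll_iff_card_of_ordIso using assms by (rule card_of_Times_same_infinite)
  then obtain p :: "'u \<times> 'u \<Rightarrow> 'u" where "bij p"
    unfolding eqpoll_def UNIV_Times_UNIV by blast
  then have p: "bij (inv p)" by (simp add: bij_imp_bij_inv)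
  have "bij (map_prod (inv p) (inv p))"
    using p by (simp add: bij_def prod.inj_map map_prod_surj)
  then have "bij (map_prod (inv p) (inv p) \<circ> inv p)" using p by (rule bij_comp[rotated])
  then show thesis by (rule that)
qed

locale modular_variety =
  fixes \<Sigma> :: "'f \<rightharpoonup> nat" and E :: "('f trm \<times> 'f trm) set" and C :: "('f, 'u) algebra set"
  assumes infinite_UNIV: "infinite (UNIV :: 'u set)" and eqs: "is_equations \<Sigma> E"
    and C_def: "C = variety \<Sigma> E" and modular: "congruence_modular C"
begin

lemma is_algebra: "M \<in> C \<Longrightarrow> is_algebra M"
  by (simp add: C_def variety_def)

text \<open>
  If \<open>(b, d) \<in> \<nu>\<close>, the four matrices \<open>x\<close>, \<open>y\<close>, \<open>z\<close>, \<open>u\<close> below form a square in which \<open>y\<close> and \<open>z\<close>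
  agree modulo \<open>\<nu>\<close> in the last entry, and the modular law carries this over to \<open>x\<close> and \<open>u\<close>.  The
  matrices on the connecting chain have top row \<open>(a, a)\<close>, so \<open>C(\<alpha>, \<beta>; \<mu>)\<close> puts their bottom
  rows into \<open>\<mu>\<close>.
\<close>

lemma centralizes_swap:
  assumes A: "A \<in> C" and con: "\<alpha> \<in> Con A" "\<beta> \<in> Con A" "\<mu> \<in> Con A" "\<nu> \<in> Con A"
    and c: "centralizes A \<alpha> \<beta> \<mu>" and le: "\<mu> \<subseteq> \<nu>"
  shows "centralizes A \<beta> \<alpha> \<nu>"
proof -
  have algA: "is_algebra A" and SigA: "Sig A = \<Sigma>" using A by (auto simp: C_def variety_def)
  note sub = Con_sub[OF con(1)] Con_sub[OF con(2)]
  obtain q :: "'u \<Rightarrow> ('u \<times> 'u) \<times> ('u \<times> 'u)" where q: "bij q"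
    using infinite_UNIV by (rule copy_into_infinite)
  \<comment> \<open>a copy of \<open>mat A \<alpha> \<beta>\<close> with carrier in the universe type, where \<open>C\<close> lives\<close>
  define R where "R = \<lparr>Sig = \<Sigma>, Carr = {r. q r \<in> mat A \<alpha> \<beta>},
    Op = \<lambda>g rs. inv q (Op (sq (sq A)) g (map q rs))\<rparr>"
  have q_inv [simp]: "q (inv q v) = v" for v using q by (simp add: bij_is_surj surj_f_inv_f)
  have CarrR: "r \<in> Carr R \<longleftrightarrow> q r \<in> mat A \<alpha> \<beta>" for r by (simp add: R_def)
  have hom_q: "alg_hom R (sq (sq A)) q"
  proof (rule alg_homI)
    show "q x \<in> Carr (sq (sq A))" if "x \<in> Carr R" for x
      using that mat_Carr[OF algA sub] CarrR by blast
  qed (simp_all add: R_def SigA)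
  have algR: "is_algebra R"
    unfolding is_algebra_def
  proof (intro conjI allI impI)
    obtain x where "x \<in> Carr A" using algA by (auto simp: is_algebra_def)
    then have "((x, x), (x, x)) \<in> mat A \<alpha> \<beta>" by (intro mat_left Con_refl[OF con(1)])
    then have "inv q ((x, x), (x, x)) \<in> Carr R" by (simp add: CarrR)
    then show "Carr R \<noteq> {}" by blast
    fix g n rs assume *: "Sig R g = Some n \<and> length rs = n \<and> set rs \<subseteq> Carr R"
    have "Op (sq (sq A)) g (map q rs) \<in> mat A \<alpha> \<beta>"
      unfolding mat_def
    proof (rule Sg.op)
      show "Sig (sq (sq A)) g = Some (length (map q rs))" using * by (simp add: R_def SigA)
      show "x \<in> Sg (sq (sq A)) ((\<lambda>(x, y). ((x, x), (y, y))) ` \<alpha> \<union> (\<lambda>(x, y). ((x, y), (x, y))) ` \<beta>)"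
        if "x \<in> set (map q rs)" for x
        using that * CarrR unfolding mat_def by auto
    qed
    then have "q (Op R g rs) \<in> mat A \<alpha> \<beta>"
      by (simp add: R_def del: sq_simps)
    then show "Op R g rs \<in> Carr R" by (simp add: CarrR)
  qed
  define p1 p2 p3 p4 where "p1 = fst \<circ> (fst \<circ> q)" "p2 = snd \<circ> (fst \<circ> q)"
    "p3 = fst \<circ> (snd \<circ> q)" "p4 = snd \<circ> (snd \<circ> q)"
  note p = this
  have hom: "alg_hom R A p1" "alg_hom R A p2" "alg_hom R A p3" "alg_hom R A p4"
    unfolding p
    by (rule alg_hom_comp[OF alg_hom_comp[OF hom_q]], rule alg_hom_fst alg_hom_snd,
        rule alg_hom_fst alg_hom_snd)+
  have q_p: "q r = ((p1 r, p2 r), (p3 r, p4 r))" for r by (simp add: p)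
  have p_inv [simp]: "p1 (inv q ((a, b), (c, d))) = a" "p2 (inv q ((a, b), (c, d))) = b"
    "p3 (inv q ((a, b), (c, d))) = c" "p4 (inv q ((a, b), (c, d))) = d" for a b c d
    by (simp_all add: p)
  \<comment> \<open>The four entries are homomorphisms to \<open>A\<close>, and they separate points
    because \<open>q\<close> is injective.\<close>
  have R: "R \<in> C"
    unfolding C_def
  proof (rule subdirect_in_variety[OF algR _ eqs _ A[unfolded C_def]])
    show "alg_hom R A h" if "h \<in> {p1, p2, p3, p4}" for h using that hom by auto
    show "x = y" if "\<And>h. h \<in> {p1, p2, p3, p4} \<Longrightarrow> h x = h y" for x y
    proof -
      have "q x = q y" using that by (simp add: q_p)
      then show ?thesis using q by (simp add: bij_is_inj inj_eq)
    qed
  qed (simp add: R_def)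
  have main: "(a, c) \<in> \<nu>" if m: "((a, b), (c, d)) \<in> mat A \<alpha> \<beta>" and bd: "(b, d) \<in> \<nu>" for a b c d
  proof -
    have ab: "(a, b) \<in> \<beta>" and ac: "(a, c) \<in> \<alpha>" using mat_cols[OF algA con(1,2) m] by auto
    then have aC: "a \<in> Carr A" using sub by (auto simp: nabla_def)
    let ?K = "\<lambda>h. pull R h (Id_on (Carr A))"
    \<comment> \<open>\<open>top\<close> is agreement in the top row, \<open>left\<close> agreement
      in the first column; \<open>bot\<close> compares last entries modulo \<nu>.\<close>
    define top left bot where "top = ?K p1 \<inter> ?K p2" "left = ?K p1 \<inter> ?K p3"
      "bot = pull R p4 \<nu>"
    note defs = this
    have K: "?K h \<in> Con R" if "alg_hom R A h" for h using pull_Con[OF algR that Id_on_Con[OF algA]] .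
    have cons: "top \<in> Con R" "left \<in> Con R" "bot \<in> Con R"
      unfolding defs using Int_Con K hom pull_Con[OF algR hom(4) con(4)] by auto
    have top_iff: "(r, s) \<in> top \<longleftrightarrow> r \<in> Carr R \<and> s \<in> Carr R \<and> p1 r = p1 s \<and> p2 r = p2 s" for r s
      using alg_hom_Carr[OF hom(1)] alg_hom_Carr[OF hom(2)] by (auto simp: defs pull_def)
    have left_iff: "(r, s) \<in> left \<longleftrightarrow> r \<in> Carr R \<and> s \<in> Carr R \<and> p1 r = p1 s \<and> p3 r = p3 s" for r s
      using alg_hom_Carr[OF hom(1)] alg_hom_Carr[OF hom(3)] by (auto simp: defs pull_def)
    define x y z u where "x = inv q ((a, a), (a, a))" "y = inv q ((a, b), (a, b))"
      "z = inv q ((a, b), (c, d))" "u = inv q ((a, a), (c, c))"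
    note xyzu = this
    have in_R: "x \<in> Carr R" "y \<in> Carr R" "z \<in> Carr R" "u \<in> Carr R"
      using m ab ac Con_refl[OF con(1) aC] by (auto simp: xyzu CarrR intro: mat_left mat_right)
    have "(x, y) \<in> left" "(z, u) \<in> left" "(x, u) \<in> top" "(y, z) \<in> top \<inter> bot"
      using in_R bd by (simp_all add: left_iff top_iff) (auto simp: xyzu defs pull_def)
    moreover have J: "con_join R (top \<inter> bot) left \<in> Con R"
      using cons by (intro con_join_Con algR Int_Con)
    moreover have "top \<inter> bot \<subseteq> con_join R (top \<inter> bot) left" "left \<subseteq> con_join R (top \<inter> bot) left"
      by (rule con_join_upper1 con_join_upper2)+
    \<comment> \<open>The path through \<open>y\<close> and \<open>z\<close> gives the join, the
      common top row gives \<open>top\<close>.\<close>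
    ultimately have "(x, u) \<in> con_join R (top \<inter> bot) left \<inter> top"
      using Con_trans[OF J] by blast
    \<comment> \<open>Modularity applies as \<open>top \<inter> bot\<close> lies below
      \<open>top\<close>; afterwards every link of the chain preserves the top row.\<close>
    also have "\<dots> = con_join R (top \<inter> bot) (left \<inter> top)"
      using modular[unfolded congruence_modular_def, rule_format,
          OF R Int_Con[OF cons(1,3)] cons(2,1)] by simp
    also have "\<dots> \<subseteq> (top \<inter> bot \<union> left \<inter> top)\<^sup>+"
      using cons by (intro con_join_subset_trancl algR Int_Con)
    finally have "(x, u) \<in> (top \<inter> bot \<union> left \<inter> top)\<^sup>+" .
    then have "p1 u = a \<and> p2 u = a \<and> (a, p4 u) \<in> \<nu>"
    proof (induction rule: trancl_induct)
      have x: "p1 x = a" "p2 x = a" "p3 x = a" "p4 x = a" by (simp_all add: xyzu)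
      have step: "p1 s = a \<and> p2 s = a \<and> (p4 r, p4 s) \<in> \<nu>"
        if rs: "(r, s) \<in> top \<inter> bot \<union> left \<inter> top" and r: "p1 r = a" "p2 r = a" for r s
      proof -
        have s: "p1 s = a" "p2 s = a" and C: "r \<in> Carr R" "s \<in> Carr R" using rs r top_iff by auto
        \<comment> \<open>A link in \<open>left \<inter> top\<close>: both matrices have top row
          \<open>(a, a)\<close>, so both bottom rows lie in \<mu>, and these begin with the same
          entry.\<close>
        have "(p4 r, p4 s) \<in> \<nu>" if "p3 r = p3 s"
        proof -
          have "((a, a), (p3 r, p4 r)) \<in> mat A \<alpha> \<beta>" "((a, a), (p3 r, p4 s)) \<in> mat A \<alpha> \<beta>"
            using C r s that by (auto simp: CarrR q_p)
          then have "(p3 r, p4 r) \<in> \<mu>" "(p3 r, p4 s) \<in> \<mu>"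
            using c Con_refl[OF con(3) aC] unfolding centralizes_iff by blast+
          then show ?thesis using le Con_sym[OF con(3)] Con_trans[OF con(3)] by blast
        qed
        then show ?thesis using s rs left_iff by (auto simp: defs pull_def)
      qed
      show "p1 s = a \<and> p2 s = a \<and> (a, p4 s) \<in> \<nu>" if "(x, s) \<in> top \<inter> bot \<union> left \<inter> top" for s
        using step[OF that] x by simp
      show "p1 s = a \<and> p2 s = a \<and> (a, p4 s) \<in> \<nu>"
        if "(r, s) \<in> top \<inter> bot \<union> left \<inter> top" "p1 r = a \<and> p2 r = a \<and> (a, p4 r) \<in> \<nu>" for r s
        using step[OF that(1)] that(2) Con_trans[OF con(4)] by blast
    qed
    then show ?thesis by (simp add: xyzu)
  qed
  show ?thesis
    unfolding centralizes_iff
  proof safe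
    \<comment> \<open>Transposing turns the claim into a comparison of the two columns of a matrix
      for \<alpha> and \<beta>; \<open>main\<close> gives one direction, and swapping the columns
      gives the other.\<close>
    fix a b c d assume m: "((a, c), (b, d)) \<in> mat A \<beta> \<alpha>"
    then have m1: "((a, b), (c, d)) \<in> mat A \<alpha> \<beta>" using mat_transpose[OF algA] sub by blast
    then have m2: "((b, a), (d, c)) \<in> mat A \<alpha> \<beta>" using mat_swap_cols[OF algA sub(1) con(2)] by blast
    show "(b, d) \<in> \<nu>" if "(a, c) \<in> \<nu>" using main[OF m2] that .
    show "(a, c) \<in> \<nu>" if "(b, d) \<in> \<nu>" using main[OF m1] that .
  qed
qed


text \<open>The point is that centralizing passes to larger congruences. Since
  \<open>centralizes_swap\<close> allows an enlargement, one swap goes from the commutator to \<mu>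
  and a second swap restores the order of the arguments.\<close>

lemma centralizes_iff_commutator:
  assumes "A \<in> C" and con: "\<alpha> \<in> Con A" "\<beta> \<in> Con A" "\<mu> \<in> Con A"
  shows "centralizes A \<alpha> \<beta> \<mu> \<longleftrightarrow> commutator A \<alpha> \<beta> \<subseteq> \<mu>"
proof
  assume le: "commutator A \<alpha> \<beta> \<subseteq> \<mu>"
  have k: "commutator A \<alpha> \<beta> \<in> Con A" using is_algebra[OF assms(1)] con by (intro commutator_Con)
  have "centralizes A \<beta> \<alpha> \<mu>"
    using assms(1) con(1,2) k con(3) centralizes_commutator le by (rule centralizes_swap)
  with assms(1) con(2,1,3,3) show "centralizes A \<alpha> \<beta> \<mu>" by (rule centralizes_swap) simp
next
  assume "centralizes A \<alpha> \<beta> \<mu>"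
  with con(3) show "commutator A \<alpha> \<beta> \<subseteq> \<mu>" by (rule commutator_least)
qed

lemma commutator_commute:
  assumes "A \<in> C" "\<alpha> \<in> Con A" "\<beta> \<in> Con A" "\<mu> \<in> Con A"
  shows "commutator A \<alpha> \<beta> \<subseteq> \<mu> \<longleftrightarrow> commutator A \<beta> \<alpha> \<subseteq> \<mu>"
  using centralizes_swap[OF assms(1-4) assms(4)] centralizes_swap[OF assms(1,3,2,4) assms(4)]
    centralizes_iff_commutator[OF assms] centralizes_iff_commutator[OF assms(1,3,2,4)] by blast

section \<open>Inverse images of prime congruences\<close>

text \<open>Both arguments are first enlarged by the kernel, so that their images are congruences of
  \<open>B\<close>. There primeness of \<psi> applies, and the adjunction leads back to
  \<open>A\<close>.\<close>

lemma pull_Spec: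
  assumes AB: "A \<in> C" "B \<in> C" and f: "alg_hom A B f" "f ` Carr A = Carr B"
    and \<psi>: "\<psi> \<in> Spec B"
  shows "pull A f \<psi> \<in> Spec A"
proof -
  note A = is_algebra[OF AB(1)] and B = is_algebra[OF AB(2)]
  let ?K = "Ker A f" and ?\<phi> = "pull A f \<psi>"
  have \<psi>C: "\<psi> \<in> Con B" and \<psi>n: "\<psi> \<noteq> nabla B" using \<psi> by (auto simp: Spec_def)
  have \<phi>: "?\<phi> \<in> Con A" using A f(1) \<psi>C by (rule pull_Con)
  have K: "?K \<in> Con A" "?K \<subseteq> ?\<phi>" using Ker_Con[OF A B f(1)] Ker_subset_pull[OF f(1) \<psi>C] by auto
  \<comment> \<open>The kernel lies below \<open>?\<phi>\<close>, hence so does its commutator with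
    \<beta>, and centralizing is preserved by joins on the left.\<close>
  have add: "commutator A (con_join A \<alpha> ?K) \<beta> \<subseteq> ?\<phi>"
    if "commutator A \<alpha> \<beta> \<subseteq> ?\<phi>" "\<alpha> \<in> Con A" "\<beta> \<in> Con A" for \<alpha> \<beta>
  proof -
    have "commutator A ?K \<beta> \<subseteq> ?\<phi>" using commutator_le(1)[OF A K(1) that(3)] K(2) by (rule order_trans)
    then have "centralizes A (con_join A \<alpha> ?K) \<beta> ?\<phi>"
      using that AB(1) A K(1) \<phi>
      by (intro centralizes_con_join) (simp_all add: centralizes_iff_commutator)
    then show ?thesis using \<phi> by (intro commutator_least)
  qed
  have "\<alpha> \<subseteq> ?\<phi> \<or> \<beta> \<subseteq> ?\<phi>" if con: "\<alpha> \<in> Con A" "\<beta> \<in> Con A" and le: "commutator A \<alpha> \<beta> \<subseteq> ?\<phi>" for \<alpha> \<beta>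
  proof -
    let ?a = "con_join A \<alpha> ?K" and ?b = "con_join A \<beta> ?K"
    have ab: "?a \<in> Con A" "?b \<in> Con A" using A con K(1) by (auto intro: con_join_Con)
    have up: "\<alpha> \<subseteq> ?a" "?K \<subseteq> ?a" "\<beta> \<subseteq> ?b" "?K \<subseteq> ?b"
      by (rule con_join_upper1 con_join_upper2)+
    \<comment> \<open>Commutativity lets \<open>add\<close> reach the second argument as
      well.\<close>
    have "commutator A \<beta> ?a \<subseteq> ?\<phi>"
      using add[OF le con] commutator_commute[OF AB(1) ab(1) con(2) \<phi>] by simp
    then have "commutator A ?b ?a \<subseteq> ?\<phi>" using con(2) ab(1) by (rule add)
    then have "centralizes A ?a ?b ?\<phi>"
      using commutator_commute[OF AB(1) ab \<phi>] centralizes_iff_commutator[OF AB(1) ab \<phi>] by simp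
    then have "centralizes B (rel_image f ?a) (rel_image f ?b) \<psi>"
      by (rule centralizes_rel_image[OF A f(1) Con_sub[OF ab(1)] Con_sub[OF ab(2)]])
    then have "commutator B (rel_image f ?a) (rel_image f ?b) \<subseteq> \<psi>" using \<psi>C by (intro commutator_least)
    moreover have "rel_image f ?a \<in> Con B" "rel_image f ?b \<in> Con B"
      using rel_image_Con[OF A f ab(1) up(2)] rel_image_Con[OF A f ab(2) up(4)] by auto
    ultimately have "rel_image f ?a \<subseteq> \<psi> \<or> rel_image f ?b \<subseteq> \<psi>" using \<psi> by (auto simp: Spec_def)
    then show ?thesis using up rel_image_subset_iff[OF Con_sub] ab by blast
  qed
  moreover have "?\<phi> \<noteq> nabla A"
  proof
    assume n: "?\<phi> = nabla A"
    have "(x, y) \<in> \<psi>" if xy: "x \<in> Carr B" "y \<in> Carr B" for x y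
    proof -
      obtain a b where ab: "a \<in> Carr A" "b \<in> Carr A" "x = f a" "y = f b"
        using xy unfolding f(2)[symmetric] by blast
      then have "(a, b) \<in> ?\<phi>" by (simp add: n nabla_def)
      then show ?thesis using ab by (simp add: pull_def)
    qed
    then have "nabla B \<subseteq> \<psi>" by (auto simp: nabla_def)
    then show False using \<psi>n Con_sub[OF \<psi>C] by blast
  qed
  ultimately show ?thesis using \<phi> unfolding Spec_def by blast
qed

end

section \<open>The lattice of radical classes\<close>

text \<open>For congruences, these are the closed sets of the hull-kernel (Zariski) topology on the
  spectrum.\<close>

definition V :: "('f, 'u) algebra \<Rightarrow> 'u rel \<Rightarrow> 'u rel set" where
  "V M \<alpha> = {\<phi> \<in> Spec M. \<alpha> \<subseteq> \<phi>}"

lemma V_con_join: "V M (con_join M \<alpha> \<beta>) = V M \<alpha> \<inter> V M \<beta>"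
proof -
  have "con_join M \<alpha> \<beta> \<subseteq> \<phi> \<longleftrightarrow> \<alpha> \<subseteq> \<phi> \<and> \<beta> \<subseteq> \<phi>" if "\<phi> \<in> Spec M" for \<phi>
    using that by (simp add: Spec_def con_join_subset_iff)
  then show ?thesis unfolding V_def by blast
qed

text \<open>One inclusion is primeness, the other is \<open>commutator_le\<close>.\<close>

lemma V_commutator:
  assumes "is_algebra M" "\<alpha> \<in> Con M" "\<beta> \<in> Con M"
  shows "V M (commutator M \<alpha> \<beta>) = V M \<alpha> \<union> V M \<beta>"
  using commutator_le[OF assms] assms(2,3) unfolding V_def Spec_def by blast

text \<open>A congruence belongs to its own class, and \<open>V\<close> can be recovered from the
  radical because a prime contains \<theta> iff it contains \<open>rad M \<theta>\<close>.\<close>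

lemma rad_class_eq_iff:
  assumes "\<alpha> \<in> Con M" "\<beta> \<in> Con M"
  shows "rad_class M \<alpha> = rad_class M \<beta> \<longleftrightarrow> V M \<alpha> = V M \<beta>"
proof -
  have "rad_class M \<alpha> = rad_class M \<beta> \<longleftrightarrow> rad M \<alpha> = rad M \<beta>"
    using assms unfolding rad_class_def rad_eq_def by auto
  also have "\<dots> \<longleftrightarrow> V M \<alpha> = V M \<beta>"
  proof
    have V: "V M \<theta> = {\<phi> \<in> Spec M. rad M \<theta> \<subseteq> \<phi>}" if "\<theta> \<in> Con M" for \<theta>
      using Con_sub[OF that] unfolding V_def rad_def by blast
    assume "rad M \<alpha> = rad M \<beta>"
    then show "V M \<alpha> = V M \<beta>" by (simp add: V assms)
  qed (simp add: rad_def V_def)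
  finally show ?thesis .
qed

lemma rad_class_iff:
  assumes "\<alpha> \<in> Con M" shows "\<beta> \<in> rad_class M \<alpha> \<longleftrightarrow> \<beta> \<in> Con M \<and> V M \<beta> = V M \<alpha>"
proof
  assume "\<beta> \<in> rad_class M \<alpha>"
  then have "\<beta> \<in> Con M" "rad_class M \<beta> = rad_class M \<alpha>"
    by (auto simp: rad_class_def rad_eq_def)
  then show "\<beta> \<in> Con M \<and> V M \<beta> = V M \<alpha>" using rad_class_eq_iff assms by blast
next
  assume "\<beta> \<in> Con M \<and> V M \<beta> = V M \<alpha>"
  then have "\<beta> \<in> Con M" "rad_class M \<beta> = rad_class M \<alpha>" using rad_class_eq_iff assms by blast+
  then show "\<beta> \<in> rad_class M \<alpha>" by (auto simp: rad_class_def rad_eq_def)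
qed

text \<open>All sets in the union defining \<open>L_join\<close> coincide, since \<open>V\<close> of
  a join depends only on \<open>V\<close> of its operands; \<alpha> and \<beta> themselves make the
  union nonempty.\<close>

lemma L_join_class:
  assumes M: "is_algebra M" and fg: "\<alpha> \<in> fg_Con M" "\<beta> \<in> fg_Con M"
  shows "L_join M (rad_class M \<alpha>) (rad_class M \<beta>) = rad_class M (con_join M \<alpha> \<beta>)"
proof -
  note con = fg_Con_Con[OF M fg(1)] fg_Con_Con[OF M fg(2)]
  have "rad_class M (con_join M \<alpha>' \<beta>') = rad_class M (con_join M \<alpha> \<beta>)"
    if "\<alpha>' \<in> rad_class M \<alpha>" "\<beta>' \<in> rad_class M \<beta>" for \<alpha>' \<beta>'
    using that con M by (simp add: rad_class_eq_iff rad_class_iff V_con_join con_join_Con)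
  moreover have "\<alpha> \<in> rad_class M \<alpha>" "\<beta> \<in> rad_class M \<beta>" using con by (simp_all add: rad_class_iff)
  ultimately show ?thesis unfolding L_join_def using fg by blast
qed

lemma L_meet_class:
  assumes M: "is_algebra M" and fg: "\<alpha> \<in> fg_Con M" "\<beta> \<in> fg_Con M"
  shows "L_meet M (rad_class M \<alpha>) (rad_class M \<beta>) = rad_class M (commutator M \<alpha> \<beta>)"
proof -
  note con = fg_Con_Con[OF M fg(1)] fg_Con_Con[OF M fg(2)]
  have "rad_class M (commutator M \<alpha>' \<beta>') = rad_class M (commutator M \<alpha> \<beta>)"
    if "\<alpha>' \<in> rad_class M \<alpha>" "\<beta>' \<in> rad_class M \<beta>" for \<alpha>' \<beta>'
    using that con M by (simp add: rad_class_eq_iff rad_class_iff V_commutator commutator_Con)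
  moreover have "\<alpha> \<in> rad_class M \<alpha>" "\<beta> \<in> rad_class M \<beta>" using con by (simp_all add: rad_class_iff)
  ultimately show ?thesis unfolding L_meet_def using fg by blast
qed

text \<open>Through \<open>V\<close>, join and meet become intersection and union, so the laws
  reduce to set identities; \<open>closed\<close> keeps meets inside the carrier.\<close>

lemma lattice_on_L:
  assumes M: "is_algebra M"
    and closed: "\<And>\<alpha> \<beta>. \<alpha> \<in> fg_Con M \<Longrightarrow> \<beta> \<in> fg_Con M \<Longrightarrow> commutator M \<alpha> \<beta> \<in> fg_Con M"
  shows "lattice_on (L_carrier M) (L_join M) (L_meet M)"
  unfolding lattice_on_def L_carrier_def ball_simps
  by (intro conjI ballI imageI;
      simp add: L_join_class L_meet_class M closed con_join_fg rad_class_eq_iff fg_Con_Con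
        con_join_Con commutator_Con V_con_join V_commutator)
    (blast intro: con_join_fg closed M)+

section \<open>Functoriality along surjective morphisms\<close>

text \<open>The left side is a congruence containing the image of \<open>X\<close>; conversely the
  inverse image of the right side contains both \<open>X\<close> and the kernel. Preservation of
  finite generation and surjectivity both rest on this.\<close>

lemma rel_image_con_join_Cg:
  assumes A: "is_algebra A" and B: "is_algebra B" and f: "alg_hom A B f" "f ` Carr A = Carr B"
    and X: "X \<subseteq> nabla A"
  shows "rel_image f (con_join A (Cg A X) (Ker A f)) = Cg B (rel_image f X)"
proof
  have \<alpha>: "Cg A X \<in> Con A" using A X by (rule Cg_Con)
  let ?j = "con_join A (Cg A X) (Ker A f)"
  have j: "?j \<in> Con A" using A \<alpha> Ker_Con[OF A B f(1)] by (rule con_join_Con)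
  have up: "Cg A X \<subseteq> ?j" "Ker A f \<subseteq> ?j" by (rule con_join_upper1 con_join_upper2)+
  have "rel_image f X \<subseteq> rel_image f ?j"
    using up(1) Cg_upper[of X A] unfolding rel_image_def by blast
  then show "Cg B (rel_image f X) \<subseteq> rel_image f ?j"
    using rel_image_Con[OF A f j up(2)] by (rule Cg_least[rotated])
  have "rel_image f X \<subseteq> nabla B"
    using X alg_hom_Carr[OF f(1)] by (auto simp: rel_image_def nabla_def)
  then have C: "Cg B (rel_image f X) \<in> Con B" using B by (intro Cg_Con)
  have P: "pull A f (Cg B (rel_image f X)) \<in> Con A" using A f(1) C by (rule pull_Con)
  have "X \<subseteq> pull A f (Cg B (rel_image f X))"
    using rel_image_subset_iff[OF X] Cg_upper by blast
  then have "?j \<subseteq> pull A f (Cg B (rel_image f X))"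
    using Ker_subset_pull[OF f(1) C] by (simp add: con_join_subset_iff[OF P] Cg_subset_iff[OF P])
  then show "rel_image f ?j \<subseteq> Cg B (rel_image f X)"
    using rel_image_subset_iff[OF Con_sub[OF j]] by blast
qed


lemma rel_image_con_join_fg:
  assumes A: "is_algebra A" and B: "is_algebra B" and f: "alg_hom A B f" "f ` Carr A = Carr B"
    and \<alpha>: "\<alpha> \<in> fg_Con A"
  shows "rel_image f (con_join A \<alpha> (Ker A f)) \<in> fg_Con B"
proof -
  obtain X where X: "finite X" "X \<subseteq> nabla A" "\<alpha> = Cg A X" using \<alpha> by (auto simp: fg_Con_def)
  have e: "rel_image f X = map_prod f f ` X" by (auto simp: rel_image_def)
  have "rel_image f X \<subseteq> nabla B" "finite (rel_image f X)"
    using X alg_hom_Carr[OF f(1)] by (auto simp: e nabla_def)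
  then show ?thesis
    unfolding X(3) rel_image_con_join_Cg[OF A B f X(2)] fg_Con_def by blast
qed

text \<open>A finite generating set of \<beta> is lifted pair by pair through the
  surjection.\<close>

lemma fg_Con_rel_image_surj:
  assumes A: "is_algebra A" and B: "is_algebra B" and f: "alg_hom A B f" "f ` Carr A = Carr B"
    and \<beta>: "\<beta> \<in> fg_Con B"
  obtains \<alpha> where "\<alpha> \<in> fg_Con A" "rel_image f (con_join A \<alpha> (Ker A f)) = \<beta>"
proof -
  obtain Y where Y: "finite Y" "Y \<subseteq> nabla B" "\<beta> = Cg B Y" using \<beta> by (auto simp: fg_Con_def)
  have "nabla B = map_prod f f ` nabla A"
    using f(2) by (simp add: nabla_def map_prod_surj_on[OF refl refl])
  then obtain X where X: "X \<subseteq> nabla A" "finite X" "Y = map_prod f f ` X"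
    using finite_subset_image[OF Y(1)] Y(2) by metis
  have "rel_image f X = Y" by (auto simp: X(3) rel_image_def)
  then have "rel_image f (con_join A (Cg A X) (Ker A f)) = \<beta>"
    using rel_image_con_join_Cg[OF A B f X(1)] Y(3) by simp
  moreover have "Cg A X \<in> fg_Con A" using X by (auto simp: fg_Con_def)
  ultimately show thesis by (rule that[rotated])
qed

text \<open>Inverse images contain the kernel, so joining with it imposes no further condition;
  \<open>pull_Spec\<close> ensures that they are primes of \<open>A\<close>.\<close>

lemma (in modular_variety) V_rel_image_con_join:
  assumes AB: "A \<in> C" "B \<in> C" and f: "alg_hom A B f" "f ` Carr A = Carr B" and \<alpha>: "\<alpha> \<in> Con A"
  shows "V B (rel_image f (con_join A \<alpha> (Ker A f))) = {\<psi> \<in> Spec B. pull A f \<psi> \<in> V A \<alpha>}"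
proof -
  note A = is_algebra[OF AB(1)] and B = is_algebra[OF AB(2)]
  have j: "con_join A \<alpha> (Ker A f) \<in> Con A" using A \<alpha> Ker_Con[OF A B f(1)] by (rule con_join_Con)
  have "rel_image f (con_join A \<alpha> (Ker A f)) \<subseteq> \<psi> \<longleftrightarrow> pull A f \<psi> \<in> V A \<alpha>" if "\<psi> \<in> Spec B" for \<psi>
  proof -
    have \<psi>: "\<psi> \<in> Con B" using that by (simp add: Spec_def)
    show ?thesis
      using Ker_subset_pull[OF f(1) \<psi>] pull_Spec[OF AB f that]
      by (simp add: V_def rel_image_subset_iff[OF Con_sub[OF j]]
          con_join_subset_iff[OF pull_Con[OF A f(1) \<psi>]])
  qed
  then show ?thesis unfolding V_def[of B] by blast
qed

lemma L_map_class:
  assumes A: "is_algebra A" and \<alpha>: "\<alpha> \<in> fg_Con A"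
    and wd: "\<And>\<alpha>'. \<alpha>' \<in> fg_Con A \<Longrightarrow> rad_class A \<alpha>' = rad_class A \<alpha> \<Longrightarrow>
      rad_class B (rel_image f (con_join A \<alpha>' (Ker A f))) =
      rad_class B (rel_image f (con_join A \<alpha> (Ker A f)))"
  shows "L_map A B f (rad_class A \<alpha>) = rad_class B (rel_image f (con_join A \<alpha> (Ker A f)))"
proof -
  have c: "\<alpha> \<in> Con A" using A \<alpha> by (rule fg_Con_Con)
  have "rad_class A \<alpha>' = rad_class A \<alpha>" if "\<alpha>' \<in> rad_class A \<alpha>" for \<alpha>'
    using that c by (simp add: rad_class_iff rad_class_eq_iff)
  moreover have "\<alpha> \<in> rad_class A \<alpha>" using c by (simp add: rad_class_iff)
  ultimately show ?thesis unfolding L_map_def using wd \<alpha> by blast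
qed

theorem proposition9p2:
  fixes \<Sigma> :: "'f \<rightharpoonup> nat"
    and E :: "('f trm \<times> 'f trm) set"
    and C :: "('f, 'u) algebra set"
    and A B :: "('f, 'u) algebra"
    and f :: "'u \<Rightarrow> 'u"
  assumes universe: "infinite (UNIV :: 'u set)" "dom \<Sigma> \<lesssim> (UNIV :: 'u set)"
    and "is_equations \<Sigma> E"
    and C: "C = variety \<Sigma> E"
    and "congruence_modular C"
    and "semi_degenerate C"
    and "\<forall>M \<in> C. \<forall>\<alpha> \<in> fg_Con M. \<forall>\<beta> \<in> fg_Con M. commutator M \<alpha> \<beta> \<in> fg_Con M"
    and "A \<in> C" "B \<in> C"
    and "alg_hom A B f"
    and "f ` Carr A = Carr B"
  shows "(\<forall>\<alpha> \<in> fg_Con A. rel_image f (con_join A \<alpha> (Ker A f)) \<in> fg_Con B)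
    \<and> (\<forall>\<alpha> \<in> fg_Con A. \<forall>\<beta> \<in> fg_Con A. rad_class A \<alpha> = rad_class A \<beta> \<longrightarrow>
         rad_class B (rel_image f (con_join A \<alpha> (Ker A f))) =
         rad_class B (rel_image f (con_join A \<beta> (Ker A f))))
    \<and> (\<forall>\<alpha> \<in> fg_Con A. L_map A B f (rad_class A \<alpha>) =
         rad_class B (rel_image f (con_join A \<alpha> (Ker A f))))
    \<and> lattice_morphism_on (L_carrier A) (L_join A) (L_meet A)
                          (L_carrier B) (L_join B) (L_meet B) (L_map A B f)
    \<and> L_map A B f ` L_carrier A = L_carrier B"
proof -
  interpret modular_variety \<Sigma> E C by unfold_locales (fact assms)+
  note A = is_algebra[OF \<open>A \<in> C\<close>] and B = is_algebra[OF \<open>B \<in> C\<close>]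
  note f = \<open>alg_hom A B f\<close> \<open>f ` Carr A = Carr B\<close>
  have closed: "commutator M \<alpha> \<beta> \<in> fg_Con M"
    if "M \<in> C" "\<alpha> \<in> fg_Con M" "\<beta> \<in> fg_Con M" for M \<alpha> \<beta>
    using assms(7) that by blast
  let ?F = "\<lambda>\<alpha>. rel_image f (con_join A \<alpha> (Ker A f))"
  have fg: "?F \<alpha> \<in> fg_Con B" if "\<alpha> \<in> fg_Con A" for \<alpha>
    using A B f that by (rule rel_image_con_join_fg)
  have V: "V B (?F \<alpha>) = {\<psi> \<in> Spec B. pull A f \<psi> \<in> V A \<alpha>}" if "\<alpha> \<in> fg_Con A" for \<alpha>
    using \<open>A \<in> C\<close> \<open>B \<in> C\<close> f fg_Con_Con[OF A that] by (rule V_rel_image_con_join)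
  \<comment> \<open>By \<open>V\<close> the value depends on \<alpha> only through
    \<open>V A \<alpha>\<close>, which the class determines.\<close>
  have wd: "rad_class B (?F \<alpha>) = rad_class B (?F \<beta>)"
    if "\<alpha> \<in> fg_Con A" "\<beta> \<in> fg_Con A" "rad_class A \<alpha> = rad_class A \<beta>" for \<alpha> \<beta>
    using that by (simp add: rad_class_eq_iff fg_Con_Con A B fg V)
  have map: "L_map A B f (rad_class A \<alpha>) = rad_class B (?F \<alpha>)" if "\<alpha> \<in> fg_Con A" for \<alpha>
    using A that by (rule L_map_class) (rule wd[OF _ that])
  \<comment> \<open>For joins, and then for commutators, the identity holds because taking preimages
    under \<open>pull A f\<close> commutes with intersections and unions.\<close>
  have join: "rad_class B (?F (con_join A \<alpha> \<beta>)) = rad_class B (con_join B (?F \<alpha>) (?F \<beta>))"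
    if "\<alpha> \<in> fg_Con A" "\<beta> \<in> fg_Con A" for \<alpha> \<beta>
    using that con_join_fg[OF A that]
    by (auto simp: rad_class_eq_iff fg_Con_Con A B fg V V_con_join con_join_Con)
  have meet: "rad_class B (?F (commutator A \<alpha> \<beta>)) = rad_class B (commutator B (?F \<alpha>) (?F \<beta>))"
    if "\<alpha> \<in> fg_Con A" "\<beta> \<in> fg_Con A" for \<alpha> \<beta>
    using that closed[OF \<open>A \<in> C\<close> that]
    by (auto simp: rad_class_eq_iff fg_Con_Con A B fg V V_commutator commutator_Con)
  have surj: "L_map A B f ` L_carrier A = L_carrier B"
  proof
    show "L_map A B f ` L_carrier A \<subseteq> L_carrier B"
      by (auto simp: L_carrier_def map fg)
    show "L_carrier B \<subseteq> L_map A B f ` L_carrier A"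
    proof
      fix Y assume "Y \<in> L_carrier B"
      then obtain \<beta> where \<beta>: "\<beta> \<in> fg_Con B" "Y = rad_class B \<beta>" by (auto simp: L_carrier_def)
      obtain \<alpha> where \<alpha>: "\<alpha> \<in> fg_Con A" "?F \<alpha> = \<beta>"
        using A B f \<beta>(1) by (rule fg_Con_rel_image_surj)
      then have "Y = L_map A B f (rad_class A \<alpha>)" by (simp add: map \<beta>(2))
      then show "Y \<in> L_map A B f ` L_carrier A" using \<alpha>(1) by (simp add: L_carrier_def)
    qed
  qed
  have "lattice_on (L_carrier A) (L_join A) (L_meet A)" "lattice_on (L_carrier B) (L_join B) (L_meet B)"
    using \<open>A \<in> C\<close> \<open>B \<in> C\<close> by (simp_all add: lattice_on_L is_algebra closed)
  moreover have "L_map A B f (L_join A X Y) = L_join B (L_map A B f X) (L_map A B f Y)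
      \<and> L_map A B f (L_meet A X Y) = L_meet B (L_map A B f X) (L_map A B f Y)"
    if XY: "X \<in> L_carrier A" "Y \<in> L_carrier A" for X Y
  proof -
    obtain \<alpha> \<beta> where "\<alpha> \<in> fg_Con A" "\<beta> \<in> fg_Con A" "X = rad_class A \<alpha>" "Y = rad_class A \<beta>"
      using XY by (auto simp: L_carrier_def)
    then show ?thesis
      using closed[OF \<open>A \<in> C\<close>]
      by (simp add: L_join_class L_meet_class A B map fg con_join_fg join meet)
  qed
  ultimately show ?thesis
    using fg wd map surj unfolding lattice_morphism_on_def by blast
qed

end
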